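(* Assume that $z\in A_1\setminus\{0\}$ and $f=\mathbf{f}_{\rho,\sigma}(z)$ for some $(\rho,\sigma)\in\mathbb{R}^2$ with $\rho+\sigma>0$. If $C(f)=K[f]$ and $[z,w]=1$ for some $w\in A_1$, then $z$ and $w$ generate $A_1$ (as a $K$-algebra).
   Context: $K$ is a field of characteristic $0$. $A_1$ is the first Weyl algebra over $K$, i.e. the associative unital $K$-algebra generated by $p,q$ subject to $pq-qp=1$; the elements $p^iq^j$ ($i,j\in\mathbb{Z}_{\ge0}$) form a $K$-basis. $[a,b]=ab-ba$. Let $\Phi:A_1\to K[X,Y]$ be the linear isomorphism with $\Phi(p^iq^j)=X^iY^j$. For $f=\sum\alpha_{ij}X^iY^j\in K[X,Y]\setminus\{0\}$ put $E(f)=\{(i,j):\alpha_{ij}\ne0\}$, $\mathbf{v}_{\rho,\sigma}(f)=\sup\{\rho i+\sigma j:(i,j)\in E(f)\}$, and $\mathbf{f}_{\rho,\sigma}(f)=\sum\alpha_{ij}X^iY^j$, the sum over $(i,j)\in E(f)$ with $\rho i+\sigma j=\mathbf{v}_{\rho,\sigma}(f)$. For $z\in A_1\setminus\{0\}$, $\mathbf{f}_{\rho,\sigma}(z)=\mathbf{f}_{\rho,\sigma}(\Phi(z))\in K[X,Y]$. The Poisson product on $K[X,Y]$ is $\{f,g\}=\frac{\partial f}{\partial X}\frac{\partial g}{\partial Y}-\frac{\partial f}{\partial Y}\frac{\partial g}{\partial X}$. For $f\in K[X,Y]$, $C(f)=\{g\in K[X,Y]:\{f,g\}=0\}$ and $K[f]$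 is the subalgebra of polynomials in $f$ with coefficients in $K$. *)

theory Defs
  imports Complex_Main "HOL-Computational_Algebra.Polynomial" "HOL-Library.Poly_Mapping"
begin

section \<open>The first Weyl algebra\<close>

text \<open>
  The free unital associative algebra on two generators is the monoid algebra, over the
  coefficient field, of the monoid of words in the generators (under concatenation). The
  first Weyl algebra is its quotient by the two-sided ideal generated by \<open>p q - q p - 1\<close>.
\<close>

datatype gen = Gp | Gq

text \<open>Words get a type of their own: \<open>list\<close> carries a pointwise addition in
  \<open>HOL-Library.ListVector\<close>.\<close>

datatype word = Word (letters: "gen list")

instantiation word :: monoid_add
begin
definition zero_word :: word where "0 = Word []"
definition plus_word :: "word \<Rightarrow> word \<Rightarrow> word" where "u + v = Word (letters u @ letters v)"
instance by standard (auto simp: zero_word_def plus_word_def)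
end

type_synonym 'k free_algebra = "word \<Rightarrow>\<^sub>0 'k"

inductive_set weyl_ideal :: "'k::field free_algebra set" where
  rel: "Poly_Mapping.single (Word [Gp, Gq]) 1 - Poly_Mapping.single (Word [Gq, Gp]) 1 - 1
        \<in> weyl_ideal"
| add: "a \<in> weyl_ideal \<Longrightarrow> b \<in> weyl_ideal \<Longrightarrow> a + b \<in> weyl_ideal"
| left: "a \<in> weyl_ideal \<Longrightarrow> c * a \<in> weyl_ideal"
| right: "a \<in> weyl_ideal \<Longrightarrow> a * c \<in> weyl_ideal"

definition weyl_rel :: "'k::field free_algebra \<Rightarrow> 'k free_algebra \<Rightarrow> bool" where
  "weyl_rel a b \<longleftrightarrow> a - b \<in> weyl_ideal"

lemma weyl_ideal_0: "0 \<in> weyl_ideal"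
  using weyl_ideal.left[OF weyl_ideal.rel, of 0] by simp

lemma weyl_ideal_uminus: "a \<in> weyl_ideal \<Longrightarrow> - a \<in> weyl_ideal"
  using weyl_ideal.left[of a "- 1"] by simp

lemma equivp_weyl_rel: "equivp (weyl_rel :: 'k::field free_algebra \<Rightarrow> _)"
proof (rule equivpI)
  show "reflp (weyl_rel :: 'k free_algebra \<Rightarrow> _)"
    by (rule reflpI) (simp add: weyl_rel_def weyl_ideal_0)
  show "symp (weyl_rel :: 'k free_algebra \<Rightarrow> _)"
    by (rule sympI) (metis weyl_rel_def weyl_ideal_uminus minus_diff_eq)
  show "transp (weyl_rel :: 'k free_algebra \<Rightarrow> _)"
  proof (rule transpI)
    fix x y z :: "'k free_algebra"
    assume "weyl_rel x y" "weyl_rel y z"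
    then have "(x - y) + (y - z) \<in> weyl_ideal"
      unfolding weyl_rel_def by (rule weyl_ideal.add)
    moreover have "(x - y) + (y - z) = x - z" by simp
    ultimately show "weyl_rel x z" unfolding weyl_rel_def by metis
  qed
qed

lemma weyl_rel_refl [simp]: "weyl_rel x x"
  by (rule equivp_reflp[OF equivp_weyl_rel])

quotient_type (overloaded) 'k weyl = "'k::field free_algebra" / weyl_rel
  by (rule equivp_weyl_rel)

text \<open>
  The free algebra acts on \<open>K[X,Y]\<close>, with \<open>p\<close> acting as multiplication by \<open>X\<close> and \<open>q\<close> as
  \<open>Y - \<partial>/\<partial>X\<close>; the ideal acts by zero. This shows that the quotient is not the zero ring and
  that the elements \<open>p\<^sup>i q\<^sup>j\<close> are linearly independent. Here and below, \<open>K[X,Y]\<close> is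
  \<open>'k poly poly\<close>, the polynomials in \<open>Y\<close> with coefficients in \<open>K[X]\<close>: the coefficient of
  \<open>X\<^sup>i Y\<^sup>j\<close> in \<open>f\<close> is \<open>coeff (coeff f j) i\<close>.
\<close>

definition dX :: "'k::field poly poly \<Rightarrow> 'k poly poly" where
  "dX f = map_poly pderiv f"

definition dY :: "'k::field poly poly \<Rightarrow> 'k poly poly" where
  "dY f = pderiv f"

lemma coeff_dX: "coeff (dX f) j = pderiv (coeff f j)"
  by (simp add: dX_def coeff_map_poly)

lemma dX_add: "dX (f + g) = dX f + dX g"
  by (rule poly_eqI) (simp add: coeff_dX pderiv_add)

lemma dX_smult: "dX (smult a f) = smult (pderiv a) f + smult a (dX f)"
  by (rule poly_eqI) (simp add: coeff_dX pderiv_mult algebra_simps)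

lemma dX_const: "dX (smult [:c:] f) = smult [:c:] (dX f)"
  by (simp add: dX_smult pderiv_pCons)

fun gen_act :: "gen \<Rightarrow> 'k::field poly poly \<Rightarrow> 'k poly poly" where
  "gen_act Gp g = smult [:0, 1:] g"
| "gen_act Gq g = pCons 0 g - dX g"

definition word_act :: "word \<Rightarrow> 'k::field poly poly \<Rightarrow> 'k poly poly" where
  "word_act w = foldr gen_act (letters w)"

definition free_act :: "'k::field free_algebra \<Rightarrow> 'k poly poly \<Rightarrow> 'k poly poly" where
  "free_act x g = (\<Sum>w\<in>Poly_Mapping.keys x. smult [:Poly_Mapping.lookup x w:] (word_act w g))"

lemma free_act_superset:
  assumes "finite S" "Poly_Mapping.keys x \<subseteq> S"
  shows "free_act x g = (\<Sum>w\<in>S. smult [:Poly_Mapping.lookup x w:] (word_act w g))"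
  unfolding free_act_def
  by (rule sum.mono_neutral_left) (use assms in \<open>auto simp: in_keys_iff\<close>)

lemma free_act_add: "free_act (x + y) g = free_act x g + free_act y g"
proof -
  let ?S = "Poly_Mapping.keys x \<union> Poly_Mapping.keys y"
  have *: "smult [:a + b:] f = smult [:a:] f + smult [:b:] f" for a b :: 'a and f
    by (metis add_0 add_pCons smult_add_left)
  have "free_act x g = (\<Sum>w\<in>?S. smult [:Poly_Mapping.lookup x w:] (word_act w g))"
    "free_act y g = (\<Sum>w\<in>?S. smult [:Poly_Mapping.lookup y w:] (word_act w g))"
    "free_act (x + y) g = (\<Sum>w\<in>?S. smult [:Poly_Mapping.lookup (x + y) w:] (word_act w g))"
    using keys_add[of x y] by (auto intro!: free_act_superset)
  then show ?thesis by (simp only: lookup_add * sum.distrib)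
qed

lemma free_act_0 [simp]: "free_act 0 g = 0"
  by (simp add: free_act_def)

lemma free_act_diff: "free_act (x - y) g = free_act x g - free_act y g"
  using free_act_add[of "x - y" y g] by (simp add: algebra_simps)

lemma free_act_single: "free_act (Poly_Mapping.single w c) g = smult [:c:] (word_act w g)"
  by (subst free_act_superset[where S = "{w}"]) auto

lemma gen_act_add: "gen_act a (f + g) = gen_act a f + gen_act a g"
  by (cases a) (simp_all add: dX_add smult_add_right)

lemma gen_act_smult: "gen_act a (smult [:c:] f) = smult [:c:] (gen_act a f)"
  by (cases a) (simp_all add: dX_const smult_diff_right)

lemma word_act_0 [simp]: "word_act 0 g = g"
  by (simp add: word_act_def zero_word_def)

lemma word_act_plus: "word_act (u + v) g = word_act u (word_act v g)"
  by (simp add: word_act_def plus_word_def)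

lemma word_act_add: "word_act w (f + g) = word_act w f + word_act w g"
proof -
  have "foldr gen_act us (f + g) = foldr gen_act us f + foldr gen_act us g" for us
    by (induction us) (simp_all add: gen_act_add)
  then show ?thesis by (simp add: word_act_def)
qed

lemma word_act_smult: "word_act w (smult [:c:] f) = smult [:c:] (word_act w f)"
proof -
  have "foldr gen_act us (smult [:c:] f) = smult [:c:] (foldr gen_act us f)" for us
    by (induction us) (simp_all add: gen_act_smult)
  then show ?thesis by (simp add: word_act_def)
qed

lemma free_act_add_right: "free_act x (f + g) = free_act x f + free_act x g"
  by (simp add: free_act_def word_act_add smult_add_right sum.distrib)

lemma word_act_zero_right [simp]: "word_act w 0 = 0"
  using word_act_smult[of w 0 0] by simp

lemma free_act_zero_right [simp]: "free_act x 0 = 0"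
  by (simp add: free_act_def)

lemma free_algebra_induct [case_names zero add]:
  assumes "P 0" "\<And>x w c. P x \<Longrightarrow> P (Poly_Mapping.single w c + x)"
  shows "P (x :: 'k::field free_algebra)"
proof -
  have *: "P (\<Sum>w\<in>S. Poly_Mapping.single w (Poly_Mapping.lookup x w))" if "finite S" for S
    using that by induction (auto simp: assms)
  have eq: "x = (\<Sum>w\<in>Poly_Mapping.keys x. Poly_Mapping.single w (Poly_Mapping.lookup x w))"
    by (intro poly_mapping_eqI)
      (auto simp: lookup_sum lookup_single when_def in_keys_iff)
  show ?thesis by (subst eq) (rule *[OF finite_keys])
qed

lemma free_act_single_mult:
  "free_act (Poly_Mapping.single w c * y) g = smult [:c:] (word_act w (free_act y g))"
proof (induction y rule: free_algebra_induct)
  case zero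
  show ?case by simp
next
  case (add x v d)
  then show ?case
    by (simp add: distrib_left free_act_add mult_single free_act_single word_act_add
        word_act_plus word_act_smult smult_add_right mult.commute[of c d])
qed

lemma free_act_mult: "free_act (x * y) g = free_act x (free_act y g)"
  by (induction x rule: free_algebra_induct)
    (simp_all add: distrib_right free_act_add free_act_single_mult free_act_single)

lemma smult_const_1 [simp]: "smult [:1:] g = (g :: 'k::field poly poly)"
  by (rule poly_eqI) simp

lemma free_act_1 [simp]: "free_act 1 g = g"
  using free_act_single[of 0 1 g] by simp

lemma free_act_ideal: "x \<in> weyl_ideal \<Longrightarrow> free_act x g = 0"
proof (induction arbitrary: g rule: weyl_ideal.induct)
  case rel
  have "dX (smult [:0, 1:] g) = g + smult [:0, 1:] (dX g)"
    by (simp add: dX_smult pderiv_pCons)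
  then have "word_act (Word [Gp, Gq]) g - word_act (Word [Gq, Gp]) g = g"
    by (simp add: word_act_def smult_diff_right)
  then show ?case
    by (simp add: free_act_diff free_act_single)
qed (simp_all add: free_act_add free_act_mult)

instantiation weyl :: (field) ring_1
begin

lift_definition zero_weyl :: "'a weyl" is 0 .

lift_definition one_weyl :: "'a weyl" is 1 .

lift_definition plus_weyl :: "'a weyl \<Rightarrow> 'a weyl \<Rightarrow> 'a weyl" is "(+)"
  unfolding weyl_rel_def by (subst add_diff_add) (rule weyl_ideal.add)

lift_definition uminus_weyl :: "'a weyl \<Rightarrow> 'a weyl" is uminus
  unfolding weyl_rel_def by (subst minus_diff_minus) (rule weyl_ideal_uminus)

lift_definition minus_weyl :: "'a weyl \<Rightarrow> 'a weyl \<Rightarrow> 'a weyl" is "(-)"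
proof -
  fix a b c d :: "'a free_algebra"
  assume "weyl_rel a b" "weyl_rel c d"
  then have "(a - b) + - (c - d) \<in> weyl_ideal"
    unfolding weyl_rel_def by (intro weyl_ideal.add weyl_ideal_uminus)
  then show "weyl_rel (a - c) (b - d)" by (simp add: weyl_rel_def algebra_simps)
qed

lift_definition times_weyl :: "'a weyl \<Rightarrow> 'a weyl \<Rightarrow> 'a weyl" is "(*)"
proof -
  fix a b c d :: "'a free_algebra"
  assume "weyl_rel a b" "weyl_rel c d"
  then have "a - b \<in> weyl_ideal" "c - d \<in> weyl_ideal" by (simp_all add: weyl_rel_def)
  then have "(a - b) * c + b * (c - d) \<in> weyl_ideal"
    by (rule weyl_ideal.add[OF weyl_ideal.right weyl_ideal.left])
  moreover have "(a - b) * c + b * (c - d) = a * c - b * d"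
    by (simp add: left_diff_distrib right_diff_distrib)
  ultimately show "weyl_rel (a * c) (b * d)" by (simp only: weyl_rel_def)
qed

instance
proof
  fix a b c :: "'a weyl"
  show "a + b + c = a + (b + c)" "a * b * c = a * (b * c)"
    by (transfer, simp add: add.assoc mult.assoc)+
  show "a + b = b + a"
    by transfer (simp add: add.commute)
  show "0 + a = a" "- a + a = 0" "a - b = a + - b" "1 * a = a" "a * 1 = a"
    by (transfer, simp)+
  show "(a + b) * c = a * c + b * c" "a * (b + c) = a * b + a * c"
    by (transfer, simp add: distrib_left distrib_right)+
  have "\<not> weyl_rel 0 (1 :: 'a free_algebra)"
  proof
    assume "weyl_rel 0 (1 :: 'a free_algebra)"
    then have "free_act (0 - 1 :: 'a free_algebra) 1 = 0"
      unfolding weyl_rel_def by (rule free_act_ideal)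
    then show False by (simp only: free_act_diff free_act_0 free_act_1) simp
  qed
  then show "(0 :: 'a weyl) \<noteq> 1" by transfer
qed

end

lift_definition weyl_const :: "'k::field \<Rightarrow> 'k weyl" is "Poly_Mapping.single 0" .

lift_definition weyl_p :: "'k::field weyl" is "Poly_Mapping.single (Word [Gp]) 1" .

lift_definition weyl_q :: "'k::field weyl" is "Poly_Mapping.single (Word [Gq]) 1" .

lemma weyl_const_0 [simp]: "weyl_const 0 = 0"
  by transfer simp

lemma weyl_const_1 [simp]: "weyl_const 1 = 1"
  by transfer simp

lemma weyl_const_add: "weyl_const (a + b) = weyl_const a + weyl_const b"
  by transfer (simp add: single_add)

lemma weyl_const_mult: "weyl_const (a * b) = weyl_const a * weyl_const b"
  by transfer (simp add: mult_single)

lemma weyl_const_commute: "weyl_const c * x = x * weyl_const c"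
proof transfer
  fix c :: 'a and x :: "'a free_algebra"
  have "Poly_Mapping.single 0 c * x = x * Poly_Mapping.single 0 c"
    by (induction x rule: free_algebra_induct)
      (simp_all add: distrib_left distrib_right mult_single mult.commute)
  then show "weyl_rel (Poly_Mapping.single 0 c * x) (x * Poly_Mapping.single 0 c)"
    by simp
qed

definition commutator :: "'a::ring \<Rightarrow> 'a \<Rightarrow> 'a" where
  "commutator a b = a * b - b * a"

lemma commutator_p_q: "commutator weyl_p weyl_q = (1 :: 'k::field weyl)"
  unfolding commutator_def
  by transfer (simp add: weyl_rel_def mult_single plus_word_def weyl_ideal.rel)

definition is_subalgebra :: "'k::field weyl set \<Rightarrow> bool" where
  "is_subalgebra B \<longleftrightarrow> range weyl_const \<subseteq> B \<and>
     (\<forall>x\<in>B. \<forall>y\<in>B. x + y \<in> B) \<and> (\<forall>x\<in>B. \<forall>y\<in>B. x * y \<in> B)"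

definition generated_subalgebra :: "'k::field weyl set \<Rightarrow> 'k weyl set" where
  "generated_subalgebra S = is_subalgebra hull S"


section \<open>The isomorphism with the polynomial ring\<close>

definition supp :: "'k::field poly poly \<Rightarrow> (nat \<times> nat) set" where
  "supp f = {(i, j). coeff (coeff f j) i \<noteq> 0}"

definition normal_order :: "'k::field poly poly \<Rightarrow> 'k weyl" where
  "normal_order f = (\<Sum>(i, j)\<in>supp f. weyl_const (coeff (coeff f j) i) * weyl_p ^ i * weyl_q ^ j)"

definition Phi :: "'k::field weyl \<Rightarrow> 'k poly poly" where
  "Phi = inv normal_order"

lemma finite_supp [simp]: "finite (supp f)"
proof (rule finite_subset)
  show "supp f \<subseteq> (\<Union>j\<in>{..degree f}. (\<lambda>i. (i, j)) ` {..degree (coeff f j)})"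
    by (force simp: supp_def intro: le_degree)
qed simp

lemma normal_order_superset:
  assumes "finite S" "supp f \<subseteq> S"
  shows "normal_order f =
    (\<Sum>(i, j)\<in>S. weyl_const (coeff (coeff f j) i) * weyl_p ^ i * weyl_q ^ j)"
  unfolding normal_order_def
  by (rule sum.mono_neutral_left) (use assms in \<open>auto simp: supp_def\<close>)

lemma normal_order_add: "normal_order (f + g) = normal_order f + normal_order g"
proof -
  have "supp (f + g) \<subseteq> supp f \<union> supp g" by (auto simp: supp_def)
  then show ?thesis
    by (subst (1 2 3) normal_order_superset[where S = "supp f \<union> supp g"])
      (auto simp: weyl_const_add distrib_right sum.distrib case_prod_unfold)
qed

lemma normal_order_monom:
  "normal_order (monom (monom c i) j) = weyl_const c * weyl_p ^ i * weyl_q ^ j"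
  by (subst normal_order_superset[where S = "{(i, j)}"])
    (auto simp: supp_def coeff_monom split: if_splits)

lemma normal_order_0 [simp]: "normal_order 0 = 0"
  by (simp add: normal_order_def supp_def)

lemma normal_order_uminus: "normal_order (- f) = - normal_order f"
  using normal_order_add[of f "- f"] by (simp add: minus_unique)

lemma normal_order_diff: "normal_order (f - g) = normal_order f - normal_order g"
  using normal_order_add[of f "- g"] by (simp add: normal_order_uminus)

lemma normal_order_smult: "normal_order (smult [:c:] f) = weyl_const c * normal_order f"
proof -
  have "supp (smult [:c:] f) \<subseteq> supp f" by (auto simp: supp_def)
  then show ?thesis
    by (subst normal_order_superset[OF finite_supp])
      (auto simp: normal_order_def weyl_const_mult sum_distrib_left mult.assoc intro!: sum.cong)
qed

lemma poly_poly_induct [case_names zero add]: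
  assumes "P 0" "\<And>f c i j. P f \<Longrightarrow> P (monom (monom c i) j + f)"
  shows "P (f :: 'k::field poly poly)"
proof -
  have *: "P (\<Sum>(i, j)\<in>S. monom (monom (coeff (coeff f j) i) i) j)" if "finite S" for S
    using that by induction (auto simp: assms)
  have eq: "f = (\<Sum>(i, j)\<in>supp f. monom (monom (coeff (coeff f j) i) i) j)"
  proof (intro poly_eqI)
    fix n m
    have "coeff (coeff (\<Sum>(i, j)\<in>supp f. monom (monom (coeff (coeff f j) i) i) j) m) n =
      (\<Sum>x\<in>supp f. coeff (coeff (monom (monom (coeff (coeff f (snd x)) (fst x)) (fst x)) (snd x)) m) n)"
      by (simp only: coeff_sum case_prod_unfold)
    also have "\<dots> = (\<Sum>x\<in>supp f. if x = (n, m) then coeff (coeff f m) n else 0)"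
      by (rule sum.cong) (auto simp: coeff_monom)
    also have "\<dots> = (if (n, m) \<in> supp f then coeff (coeff f m) n else 0)"
      by (rule sum.delta) simp
    also have "\<dots> = coeff (coeff f m) n" by (simp add: supp_def)
    finally show "coeff (coeff f m) n =
        coeff (coeff (\<Sum>(i, j)\<in>supp f. monom (monom (coeff (coeff f j) i) i) j) m) n" ..
  qed
  show ?thesis by (subst eq) (rule *[OF finite_supp])
qed

lemma q_p_power: "weyl_q * weyl_p ^ i = weyl_p ^ i * weyl_q - of_nat i * weyl_p ^ (i - 1)"
proof (induction i)
  case (Suc i)
  have qp: "weyl_q * weyl_p = weyl_p * weyl_q - (1 :: 'a weyl)"
    using commutator_p_q[where 'k = 'a] by (simp add: commutator_def algebra_simps)
  have "weyl_q * weyl_p ^ Suc i = (weyl_q * weyl_p) * (weyl_p ^ i :: 'a weyl)"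
    by (simp add: mult.assoc)
  also have "\<dots> = weyl_p * (weyl_q * weyl_p ^ i) - weyl_p ^ i"
    by (simp add: qp algebra_simps)
  also have "\<dots> = weyl_p ^ Suc i * weyl_q - (weyl_p * of_nat i * weyl_p ^ (i - 1) + weyl_p ^ i)"
    by (simp add: Suc algebra_simps)
  also have "weyl_p * of_nat i * weyl_p ^ (i - 1) = (of_nat i * weyl_p ^ i :: 'a weyl)"
    by (cases i) (simp_all add: mult.assoc mult_of_nat_commute flip: of_nat_Suc)
  finally show ?case by (simp add: algebra_simps)
qed simp

lemma weyl_const_of_nat: "weyl_const (of_nat n) = of_nat n"
  by (induction n) (simp_all add: weyl_const_add)

lemma normal_order_gen_act:
  "normal_order (gen_act Gp f) = weyl_p * normal_order f"
  "normal_order (gen_act Gq f) = weyl_q * normal_order f"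
proof (induction f rule: poly_poly_induct)
  case (add f c i j)
  have "gen_act Gp (monom (monom c i) j) = monom (monom c (Suc i)) j"
    by (simp add: smult_monom monom_Suc)
  then have "normal_order (gen_act Gp (monom (monom c i) j)) =
      weyl_const c * weyl_p * weyl_p ^ i * weyl_q ^ j"
    by (simp only: normal_order_monom power_Suc mult.assoc)
  then have p: "normal_order (gen_act Gp (monom (monom c i) j)) =
      weyl_p * normal_order (monom (monom c i) j)"
    by (simp add: normal_order_monom weyl_const_commute[of c weyl_p] mult.assoc)
  have "gen_act Gq (monom (monom c i) j) =
      monom (monom c i) (Suc j) - monom (monom (of_nat i * c) (i - 1)) j"
    by (simp add: monom_Suc dX_def map_poly_monom pderiv_monom)
  then have "normal_order (gen_act Gq (monom (monom c i) j)) =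
      weyl_const c * weyl_p ^ i * weyl_q ^ Suc j -
      weyl_const (c * of_nat i) * weyl_p ^ (i - 1) * weyl_q ^ j"
    by (simp only: normal_order_diff normal_order_monom mult.commute[of "of_nat i" c])
  also have "\<dots> = weyl_const c * (weyl_p ^ i * weyl_q - of_nat i * weyl_p ^ (i - 1)) * weyl_q ^ j"
    by (simp add: weyl_const_mult weyl_const_of_nat left_diff_distrib right_diff_distrib mult.assoc)
  also have "\<dots> = weyl_const c * weyl_q * weyl_p ^ i * weyl_q ^ j"
    by (simp add: q_p_power mult.assoc)
  finally have q: "normal_order (gen_act Gq (monom (monom c i) j)) =
      weyl_q * normal_order (monom (monom c i) j)"
    by (simp add: normal_order_monom weyl_const_commute[of c weyl_q] mult.assoc)
  show "normal_order (gen_act Gp (monom (monom c i) j + f)) =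
      weyl_p * normal_order (monom (monom c i) j + f)"
    "normal_order (gen_act Gq (monom (monom c i) j + f)) =
      weyl_q * normal_order (monom (monom c i) j + f)"
    by (simp_all only: gen_act_add normal_order_add p q add distrib_left)
qed (simp_all add: dX_def)

lemma normal_order_free_act: "normal_order (free_act x g) = abs_weyl x * normal_order g"
proof (induction x rule: free_algebra_induct)
  case zero
  show ?case by (simp flip: zero_weyl.abs_eq)
next
  case (add x w c)
  have "normal_order (foldr gen_act us g) =
      abs_weyl (Poly_Mapping.single (Word us) 1) * normal_order g" for us
  proof (induction us)
    case Nil
    then show ?case by (simp flip: zero_word_def one_weyl.abs_eq)
  next
    case (Cons a us)
    have "abs_weyl (Poly_Mapping.single (Word (a # us)) 1) =
        abs_weyl (Poly_Mapping.single (Word [a]) (1 :: 'a)) *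
        abs_weyl (Poly_Mapping.single (Word us) 1)"
      by (simp add: times_weyl.abs_eq mult_single plus_word_def)
    with Cons show ?case
      by (cases a) (simp_all only: foldr.simps comp_apply normal_order_gen_act mult.assoc
          weyl_p_def weyl_q_def map_fun_apply id_apply)
  qed
  then have "normal_order (word_act w g) = abs_weyl (Poly_Mapping.single w 1) * normal_order g"
    by (metis word_act_def word.collapse)
  moreover have "abs_weyl (Poly_Mapping.single w c) =
      weyl_const c * abs_weyl (Poly_Mapping.single w 1)"
    by (simp add: weyl_const.abs_eq times_weyl.abs_eq mult_single)
  ultimately show ?case
    using add by (simp add: free_act_add normal_order_add free_act_single normal_order_smult
        mult.assoc distrib_right flip: plus_weyl.abs_eq)
qed

lift_definition weyl_act :: "'k::field weyl \<Rightarrow> 'k poly poly \<Rightarrow> 'k poly poly" is free_act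
proof
  fix x y :: "'k free_algebra" and g :: "'k poly poly"
  assume "weyl_rel x y"
  then have "free_act (x - y) g = 0" unfolding weyl_rel_def by (rule free_act_ideal)
  then show "free_act x g = free_act y g" by (simp add: free_act_diff)
qed

lemma weyl_act_add: "weyl_act (x + y) g = weyl_act x g + weyl_act y g"
  by transfer (rule free_act_add)

lemma weyl_act_mult: "weyl_act (x * y) g = weyl_act x (weyl_act y g)"
  by transfer (rule free_act_mult)

lemma weyl_act_simps [simp]:
  "weyl_act 0 g = 0" "weyl_act 1 g = g" "weyl_act (weyl_const c) g = smult [:c:] g"
  "weyl_act weyl_p g = gen_act Gp g" "weyl_act weyl_q g = gen_act Gq g"
  by (simp_all add: zero_weyl.abs_eq one_weyl.abs_eq weyl_const.abs_eq weyl_p.abs_eq weyl_q.abs_eq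
      weyl_act.abs_eq free_act_single word_act_def zero_word_def)

lemma weyl_act_normal_order: "weyl_act (normal_order f) 1 = f"
proof (induction f rule: poly_poly_induct)
  case (add f c i j)
  have q: "weyl_act (weyl_q ^ j) 1 = monom (1 :: 'a poly) j"
  proof (induction j)
    case (Suc j)
    have "dX (monom 1 j :: 'a poly poly) = 0"
      by (simp add: dX_def map_poly_monom)
    with Suc show ?case by (simp add: weyl_act_mult monom_Suc)
  qed simp
  have "weyl_act (weyl_p ^ i) (monom 1 j) = monom (monom (1 :: 'a) i) j"
    by (induction i) (simp_all add: weyl_act_mult smult_monom monom_Suc)
  with q add show ?case
    by (simp add: normal_order_add normal_order_monom weyl_act_add weyl_act_mult smult_monom)
qed simp

text \<open>The elements \<open>p\<^sup>i q\<^sup>j\<close> form a basis, so \<open>Phi\<close> is the linear isomorphism sending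
  \<open>p\<^sup>i q\<^sup>j\<close> to \<open>X\<^sup>i Y\<^sup>j\<close>.\<close>

lemma bij_normal_order: "bij (normal_order :: 'k::field poly poly \<Rightarrow> 'k weyl)"
proof (rule bijI)
  show "inj (normal_order :: 'k poly poly \<Rightarrow> 'k weyl)"
    by (metis injI weyl_act_normal_order)
  have "normal_order 1 = (1 :: 'k weyl)"
    using normal_order_monom[of "1 :: 'k" 0 0] by simp
  then have *: "abs_weyl x = normal_order (free_act x (1 :: 'k poly poly))" for x
    by (simp add: normal_order_free_act)
  show "surj (normal_order :: 'k poly poly \<Rightarrow> 'k weyl)"
    unfolding surj_def
  proof
    fix z :: "'k weyl"
    show "\<exists>f. z = normal_order f" by (induction z rule: weyl.abs_induct) (use * in blast)
  qed
qed

lemma bij_Phi: "bij (Phi :: 'k::field weyl \<Rightarrow> 'k poly poly)"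
  unfolding Phi_def by (rule bij_imp_bij_inv) (rule bij_normal_order)

lemma Phi_normal_order [simp]: "Phi (normal_order f) = f"
  by (simp add: Phi_def bij_is_inj bij_normal_order)

lemma normal_order_Phi [simp]: "normal_order (Phi z) = z"
  by (simp add: Phi_def bij_is_surj bij_normal_order surj_f_inv_f)

lemma Phi_add: "Phi (x + y) = Phi x + Phi y"
  by (metis Phi_normal_order normal_order_Phi normal_order_add)

lemma Phi_scale: "Phi (weyl_const c * x) = smult [:c:] (Phi x)"
  by (metis Phi_normal_order normal_order_Phi normal_order_smult)

lemma Phi_basis: "Phi (weyl_p ^ i * weyl_q ^ j) = monom (monom 1 i) j"
  by (metis Phi_normal_order normal_order_monom weyl_const_1 mult_1)


section \<open>Leading forms and the Poisson product\<close>

definition vdeg :: "real \<Rightarrow> real \<Rightarrow> 'k::field poly poly \<Rightarrow> real" where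
  "vdeg \<rho> \<sigma> f = Sup {\<rho> * real i + \<sigma> * real j | i j. (i, j) \<in> supp f}"

definition leading_form :: "real \<Rightarrow> real \<Rightarrow> 'k::field poly poly \<Rightarrow> 'k poly poly" where
  "leading_form \<rho> \<sigma> f =
    (\<Sum>(i, j)\<in>{(i, j) \<in> supp f. \<rho> * real i + \<sigma> * real j = vdeg \<rho> \<sigma> f}.
       monom (monom (coeff (coeff f j) i) i) j)"

definition weyl_leading_form :: "real \<Rightarrow> real \<Rightarrow> 'k::field weyl \<Rightarrow> 'k poly poly" where
  "weyl_leading_form \<rho> \<sigma> z = leading_form \<rho> \<sigma> (Phi z)"

definition poisson :: "'k::field poly poly \<Rightarrow> 'k poly poly \<Rightarrow> 'k poly poly" where
  "poisson f g = dX f * dY g - dY f * dX g"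

definition poisson_centralizer :: "'k::field poly poly \<Rightarrow> 'k poly poly set" where
  "poisson_centralizer f = {g. poisson f g = 0}"

text \<open>\<open>K[f]\<close>: the univariate polynomial \<open>P\<close> over \<open>K\<close> is coerced to one over \<open>K[X,Y]\<close> before
  evaluation at \<open>f\<close>.\<close>

definition polynomials_in :: "'k::field poly poly \<Rightarrow> 'k poly poly set" where
  "polynomials_in f = range (\<lambda>P :: 'k poly. poly (map_poly (\<lambda>c. [:[:c:]:]) P) f)"

end

theory Submission
  imports Defs
begin

text \<open>
  Give \<open>X\<^sup>i Y\<^sup>j\<close> the weight \<open>\<rho> i + \<sigma> j\<close>. Under \<open>Phi\<close> the product of the Weyl
  algebra becomes \<open>f g - f\<^sub>Y g\<^sub>X + \<dots>\<close>, each further term losing weight \<open>\<rho> + \<sigma>\<close>, so the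
  commutator is the Poisson product up to terms of lower weight. Hence if \<open>[z, w] = 1\<close> and \<open>f\<close>,
  \<open>g\<close> are the leading forms of \<open>z\<close>, \<open>w\<close>, of weights \<open>r\<close>, \<open>s\<close>, then either
  \<open>{f, g} = 1\<close> and \<open>r + s = \<rho> + \<sigma>\<close>, or \<open>{f, g} = 0\<close> and \<open>r + s > \<rho> + \<sigma>\<close>
  (\<open>poisson_top_parts\<close>).

  The hypothesis \<open>C(f) = K[f]\<close> serves to replace \<open>w\<close> by some \<open>w - P(z)\<close> for which
  \<open>{f, g} = 1\<close>. If \<open>{f, g} = 0\<close>, then \<open>g\<close> lies in \<open>K[f]\<close>, so \<open>s = k r\<close> for a natural
  number \<open>k\<close>. For \<open>r \<le> 0\<close> this contradicts \<open>s > \<rho> + \<sigma> - r > 0\<close>. For \<open>r > 0\<close> homogeneity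
  gives \<open>g = c f\<^sup>k\<close>, and subtracting \<open>c z\<^sup>k\<close> from \<open>w\<close> lowers \<open>s\<close>, which stays among the
  multiples of \<open>r\<close>, so this stops (\<open>subalgebra_descent\<close>).

  Once \<open>{f, g} = 1\<close>, the constant term of this equation says that the linear parts of \<open>f\<close> and
  \<open>g\<close> are independent. So, up to exchanging \<open>(z, w)\<close> with \<open>(w, -z)\<close>, the weights of
  \<open>z\<close> and \<open>w\<close> are at most those of \<open>X\<close> and \<open>Y\<close>, and one of the two elements turns out to
  be affine in \<open>p\<close> or in \<open>q\<close>, or both are affine in \<open>p, q\<close>
  (\<open>subalgebra_standard_weights\<close>). For positive \<open>\<rho>\<close> and \<open>\<sigma>\<close> this is a count of the
  monomials of small weight. The other case is \<open>affine_if_weights_nonpos\<close>: an element \<open>z\<close> with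
  \<open>[z, w] = 1\<close> and no positive weights is affine in \<open>p\<close> or in \<open>q\<close>. There the direction is
  moved along \<open>(1, 1)\<close> until the largest weight of a nonconstant monomial is \<open>0\<close>, after which
  the extreme coefficients of \<open>{f, g}\<close> leave no room for monomials of higher degree.

  Finally, if \<open>z = a p + e\<close>, then \<open>[p, w]\<close> is constant, so \<open>w\<close> is a multiple of \<open>q\<close>
  plus a polynomial in \<open>p\<close>, and \<open>p\<close>, \<open>q\<close> both lie in every subalgebra containing \<open>z\<close>
  and \<open>w\<close>.
\<close>

section \<open>Coefficients of bivariate polynomials\<close>

text \<open>The indices are in the order of the exponents of \<open>X\<^sup>i Y\<^sup>j\<close>, which is the reverse of
  the nesting of \<open>coeff\<close>.\<close>

abbreviation cf :: "'k::field poly poly \<Rightarrow> nat \<Rightarrow> nat \<Rightarrow> 'k" where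
  "cf f i j \<equiv> coeff (coeff f j) i"

lemma cf_eqI: "(\<And>i j. cf f i j = cf g i j) \<Longrightarrow> f = g"
  by (intro poly_eqI) simp

lemma cf_mult: "cf (f * g) m n = (\<Sum>j\<le>n. \<Sum>i\<le>m. cf f i j * cf g (m - i) (n - j))"
  by (simp add: coeff_mult coeff_sum)

lemma cf_dX: "cf (dX f) i j = of_nat (Suc i) * cf f (Suc i) j"
  by (simp add: coeff_dX coeff_pderiv)

lemma cf_dY: "cf (dY f) i j = of_nat (Suc j) * cf f i (Suc j)"
proof -
  have "coeff (of_nat n * p) i = of_nat n * coeff p i" for n and p :: "'a poly"
    by (induction n) (simp_all add: algebra_simps)
  then show ?thesis by (simp only: dY_def coeff_pderiv)
qed

lemma dX_diff: "dX (f - g) = dX f - dX g"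
  using dX_add[of "f - g" g] by (simp add: algebra_simps)

lemma dX_mult: "dX (f * g) = dX f * g + f * dX g"
proof (rule poly_eqI)
  fix n
  have sum_pderiv: "pderiv (\<Sum>i\<in>A. F i) = (\<Sum>i\<in>A. pderiv (F i))" for F :: "nat \<Rightarrow> 'a poly" and A
    by (induction A rule: infinite_finite_induct) (simp_all add: pderiv_add)
  have "pderiv (\<Sum>i\<le>n. coeff f i * coeff g (n - i)) =
      (\<Sum>i\<le>n. pderiv (coeff f i) * coeff g (n - i) + coeff f i * pderiv (coeff g (n - i)))"
    by (simp only: sum_pderiv pderiv_mult) (simp add: algebra_simps)
  then show "coeff (dX (f * g)) n = coeff (dX f * g + f * dX g) n"
    by (simp add: coeff_dX coeff_mult sum.distrib)
qed

lemma dY_add: "dY (f + g) = dY f + dY g"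
  by (simp add: dY_def pderiv_add)

lemma dY_mult: "dY (f * g) = dY f * g + f * dY g"
  by (simp add: dY_def pderiv_mult algebra_simps)

section \<open>Weights\<close>

text \<open>Weights are constrained by an arbitrary set, so that one predicate covers homogeneous polynomials
  (\<open>{r}\<close>) and both steps \<open>{..r}\<close> and \<open>{..<r}\<close> of the filtration.\<close>

definition weights_in :: "real \<Rightarrow> real \<Rightarrow> real set \<Rightarrow> 'k::field poly poly \<Rightarrow> bool" where
  "weights_in \<rho> \<sigma> S f \<longleftrightarrow> (\<forall>i j. cf f i j \<noteq> 0 \<longrightarrow> \<rho> * real i + \<sigma> * real j \<in> S)"

lemma weights_inD: "weights_in \<rho> \<sigma> S f \<Longrightarrow> cf f i j \<noteq> 0 \<Longrightarrow> \<rho> * real i + \<sigma> * real j \<in> S"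
  by (simp add: weights_in_def)

lemma weights_in_mono: "weights_in \<rho> \<sigma> S f \<Longrightarrow> S \<subseteq> T \<Longrightarrow> weights_in \<rho> \<sigma> T f"
  by (auto simp: weights_in_def)

lemma weights_in_0 [simp]: "weights_in \<rho> \<sigma> S 0"
  by (simp add: weights_in_def)

lemma weights_in_add:
  "weights_in \<rho> \<sigma> S f \<Longrightarrow> weights_in \<rho> \<sigma> S g \<Longrightarrow> weights_in \<rho> \<sigma> S (f + g)"
  by (simp add: weights_in_def) (metis add.right_neutral)

lemma weights_in_uminus: "weights_in \<rho> \<sigma> S f \<Longrightarrow> weights_in \<rho> \<sigma> S (- f)"
  by (simp add: weights_in_def)

lemma weights_in_diff:
  "weights_in \<rho> \<sigma> S f \<Longrightarrow> weights_in \<rho> \<sigma> S g \<Longrightarrow> weights_in \<rho> \<sigma> S (f - g)"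
  using weights_in_add[of \<rho> \<sigma> S f "- g"] weights_in_uminus[of \<rho> \<sigma> S g] by simp

lemma weights_in_sum:
  "(\<And>x. x \<in> A \<Longrightarrow> weights_in \<rho> \<sigma> S (F x)) \<Longrightarrow> weights_in \<rho> \<sigma> S (sum F A)"
  by (induction A rule: infinite_finite_induct) (auto intro: weights_in_add)

lemma weights_in_const: "weights_in \<rho> \<sigma> S f \<Longrightarrow> weights_in \<rho> \<sigma> S (smult [:c:] f)"
  by (simp add: weights_in_def)

lemma weights_in_mult:
  assumes "weights_in \<rho> \<sigma> S f" "weights_in \<rho> \<sigma> T g" "\<And>s t. s \<in> S \<Longrightarrow> t \<in> T \<Longrightarrow> s + t \<in> U"
  shows "weights_in \<rho> \<sigma> U (f * g)"
  unfolding weights_in_def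
proof (intro allI impI)
  fix m n
  assume "cf (f * g) m n \<noteq> 0"
  then obtain i j where ij: "j \<le> n" "i \<le> m" "cf f i j * cf g (m - i) (n - j) \<noteq> 0"
    unfolding cf_mult by (meson atMost_iff sum.not_neutral_contains_not_neutral)
  then have "(\<rho> * real i + \<sigma> * real j) + (\<rho> * real (m - i) + \<sigma> * real (n - j)) \<in> U"
    using assms by (intro assms(3)) (auto dest: weights_inD)
  then show "\<rho> * real m + \<sigma> * real n \<in> U"
    using ij by (simp add: of_nat_diff algebra_simps)
qed

lemma weights_in_dX:
  assumes "weights_in \<rho> \<sigma> S f" "\<And>s. s \<in> S \<Longrightarrow> s - \<rho> \<in> U"
  shows "weights_in \<rho> \<sigma> U (dX f)"
  unfolding weights_in_def
proof (intro allI impI)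
  fix i j
  assume "cf (dX f) i j \<noteq> 0"
  then have "cf f (Suc i) j \<noteq> 0" by (auto simp: cf_dX)
  from assms(2)[OF weights_inD[OF assms(1) this]]
  show "\<rho> * real i + \<sigma> * real j \<in> U" by (simp add: algebra_simps)
qed

lemma weights_in_dY:
  assumes "weights_in \<rho> \<sigma> S f" "\<And>s. s \<in> S \<Longrightarrow> s - \<sigma> \<in> U"
  shows "weights_in \<rho> \<sigma> U (dY f)"
  unfolding weights_in_def
proof (intro allI impI)
  fix i j
  assume "cf (dY f) i j \<noteq> 0"
  then have "cf f i (Suc j) \<noteq> 0" by (auto simp: cf_dY)
  from assms(2)[OF weights_inD[OF assms(1) this]]
  show "\<rho> * real i + \<sigma> * real j \<in> U" by (simp add: algebra_simps)
qed

lemma weights_in_monom: "\<rho> * real i + \<sigma> * real j \<in> S \<Longrightarrow> weights_in \<rho> \<sigma> S (monom (monom c i) j)"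
  by (auto simp: weights_in_def coeff_monom split: if_splits)

lemma weights_in_disjoint:
  "weights_in \<rho> \<sigma> S f \<Longrightarrow> weights_in \<rho> \<sigma> T f \<Longrightarrow> S \<inter> T = {} \<Longrightarrow> f = 0"
  by (rule cf_eqI) (fastforce simp: weights_in_def)

lemma cf_sum_monom:
  assumes "finite A"
  shows "cf (\<Sum>(i, j)\<in>A. monom (monom (F i j) i) j) m n = (if (m, n) \<in> A then F m n else 0)"
proof -
  have "cf (\<Sum>(i, j)\<in>A. monom (monom (F i j) i) j) m n =
      (\<Sum>x\<in>A. cf (monom (monom (F (fst x) (snd x)) (fst x)) (snd x)) m n)"
    by (simp only: coeff_sum case_prod_unfold)
  also have "\<dots> = (\<Sum>x\<in>A. if x = (m, n) then F m n else 0)"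
    by (rule sum.cong) (auto simp: coeff_monom)
  also have "\<dots> = (if (m, n) \<in> A then F m n else 0)"
    by (rule sum.delta) (fact assms)
  finally show ?thesis .
qed

lemma eq_sum_monom: "f = (\<Sum>(i, j)\<in>supp f. monom (monom (cf f i j) i) j)"
  by (rule cf_eqI) (subst cf_sum_monom[OF finite_supp], simp add: supp_def)

text \<open>Statements that are additive in \<open>f\<close> need only be checked on monomials of admissible weight.\<close>

lemma weights_in_induct [consumes 1, case_names zero add]:
  assumes "weights_in \<rho> \<sigma> S f" "P 0"
    and step: "\<And>f c i j. \<rho> * real i + \<sigma> * real j \<in> S \<Longrightarrow> P f \<Longrightarrow> P (monom (monom c i) j + f)"
  shows "P f"
proof -
  have "P (\<Sum>(i, j)\<in>A. monom (monom (cf f i j) i) j)" if "finite A" "A \<subseteq> supp f" for A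
    using that
  proof induction
    case empty
    show ?case by (simp add: assms)
  next
    case (insert x A)
    obtain i j where x: "x = (i, j)" by (cases x)
    with insert have "\<rho> * real i + \<sigma> * real j \<in> S"
      by (intro weights_inD[OF assms(1)]) (simp add: supp_def)
    with insert x show ?case by (simp add: step)
  qed
  from this[OF finite_supp order_refl] show ?thesis by (simp flip: eq_sum_monom)
qed

section \<open>Leading forms\<close>

lemma cf_leading_form:
  "cf (leading_form \<rho> \<sigma> f) i j = (if \<rho> * real i + \<sigma> * real j = vdeg \<rho> \<sigma> f then cf f i j else 0)"
proof -
  have "finite {(i, j) \<in> supp f. \<rho> * real i + \<sigma> * real j = vdeg \<rho> \<sigma> f}"
    by (rule finite_subset[OF _ finite_supp[of f]]) auto
  then show ?thesis
    unfolding leading_form_def by (subst cf_sum_monom) (auto simp: supp_def)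
qed

lemma vdeg_eq_Max:
  assumes "f \<noteq> 0"
  shows "vdeg \<rho> \<sigma> f = Max ((\<lambda>(i, j). \<rho> * real i + \<sigma> * real j) ` supp f)" "supp f \<noteq> {}"
proof -
  show ne: "supp f \<noteq> {}"
    using assms cf_eqI[of f 0] by (auto simp: supp_def)
  have "{\<rho> * real i + \<sigma> * real j | i j. (i, j) \<in> supp f} = (\<lambda>(i, j). \<rho> * real i + \<sigma> * real j) ` supp f"
    by force
  then show "vdeg \<rho> \<sigma> f = Max ((\<lambda>(i, j). \<rho> * real i + \<sigma> * real j) ` supp f)"
    using ne unfolding vdeg_def by (simp add: cSup_eq_Max)
qed

lemma weights_le_vdeg: "f \<noteq> 0 \<Longrightarrow> weights_in \<rho> \<sigma> {..vdeg \<rho> \<sigma> f} f"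
  unfolding weights_in_def vdeg_eq_Max(1) atMost_iff
  by (intro allI impI Max_ge finite_imageI finite_supp) (auto simp: supp_def intro!: rev_image_eqI)

lemma leading_form_nonzero: 
  assumes "f \<noteq> 0"
  shows "leading_form \<rho> \<sigma> f \<noteq> 0"
proof -
  let ?W = "(\<lambda>(i, j). \<rho> * real i + \<sigma> * real j) ` supp f"
  have "Max ?W \<in> ?W" using vdeg_eq_Max(2)[OF assms] by (intro Max_in) auto
  then obtain x where "x \<in> supp f" "(case x of (i, j) \<Rightarrow> \<rho> * real i + \<sigma> * real j) = vdeg \<rho> \<sigma> f"
    unfolding vdeg_eq_Max(1)[OF assms] by (metis (no_types, lifting) imageE)
  then obtain i j where "(i, j) \<in> supp f" "\<rho> * real i + \<sigma> * real j = vdeg \<rho> \<sigma> f"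
    by (cases x) simp
  then have "cf (leading_form \<rho> \<sigma> f) i j \<noteq> 0"
    by (simp add: cf_leading_form supp_def)
  then show ?thesis by auto
qed

lemma weights_in_leading_form: "weights_in \<rho> \<sigma> {vdeg \<rho> \<sigma> f} (leading_form \<rho> \<sigma> f)"
  by (auto simp: weights_in_def cf_leading_form split: if_splits)

lemma weights_in_leading_form_diff:
  "f \<noteq> 0 \<Longrightarrow> weights_in \<rho> \<sigma> {..<vdeg \<rho> \<sigma> f} (f - leading_form \<rho> \<sigma> f)"
  using weights_le_vdeg[of f \<rho> \<sigma>]
  by (fastforce simp: weights_in_def cf_leading_form less_le split: if_splits)

section \<open>Products and commutators\<close>

lemma Phi_eq_act: "Phi z = weyl_act z 1"
  by (metis normal_order_Phi weyl_act_normal_order)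

lemma Phi_mult: "Phi (z * w) = weyl_act z (Phi w)"
  by (simp add: Phi_eq_act weyl_act_mult)

lemma Phi_0 [simp]: "Phi 0 = 0" and Phi_1 [simp]: "Phi 1 = 1"
  by (simp_all add: Phi_eq_act)

lemma Phi_diff: "Phi (x - y) = Phi x - Phi y"
  using Phi_add[of "x - y" y] by (simp add: algebra_simps)

lemma Phi_uminus: "Phi (- x) = - Phi x"
  using Phi_diff[of 0 x] by simp

lemma weights_in_pCons_0:
  assumes "weights_in \<rho> \<sigma> S f" "\<And>s. s \<in> S \<Longrightarrow> s + \<sigma> \<in> U"
  shows "weights_in \<rho> \<sigma> U (pCons 0 f)"
  unfolding weights_in_def
proof (intro allI impI)
  fix i j
  assume nz: "cf (pCons 0 f) i j \<noteq> 0"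
  then obtain j' where j: "j = Suc j'" by (cases j) auto
  with nz have "cf f i j' \<noteq> 0" by simp
  from assms(2)[OF weights_inD[OF assms(1) this]]
  show "\<rho> * real i + \<sigma> * real j \<in> U" by (simp add: j algebra_simps)
qed

text \<open>\<open>q\<^sup>b\<close> acts as \<open>(Y - \<partial>/\<partial>X)\<^sup>b\<close>. Trading a factor \<open>Y\<close> for \<open>\<partial>/\<partial>X\<close> costs weight \<open>\<rho> + \<sigma>\<close>,
  so the terms with at least two derivatives are at least \<open>2 (\<rho> + \<sigma>)\<close> below the top.\<close>

lemma weyl_act_q_power:
  assumes "weights_in \<rho> \<sigma> {..s} h" "\<rho> + \<sigma> > 0"
  shows "weights_in \<rho> \<sigma> {..s + \<sigma> * real b - 2 * (\<rho> + \<sigma>)}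
    (weyl_act (weyl_q ^ b) h - (monom 1 b * h - dY (monom 1 b) * dX h))"
proof (induction b)
  case 0
  show ?case by (simp add: dY_def)
next
  case (Suc b)
  define m :: "'a poly poly" where "m = monom 1 b"
  define E where "E = weyl_act (weyl_q ^ b) h - (m * h - dY m * dX h)"
  have E: "weights_in \<rho> \<sigma> {..s + \<sigma> * real b - 2 * (\<rho> + \<sigma>)} E"
    using Suc by (simp add: E_def m_def)
  have act: "weyl_act (weyl_q ^ b) h = m * h - dY m * dX h + E" by (simp add: E_def)
  have dXm: "dX m = 0" "dX (dY m) = 0"
    by (simp_all add: m_def dX_def dY_def map_poly_monom pderiv_monom)
  define Y :: "'a poly poly" where "Y = [:0, 1:]"
  have Y: "pCons 0 g = Y * g" for g by (simp add: Y_def)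
  have m': "monom 1 (Suc b) = Y * m" by (simp add: m_def monom_Suc Y_def)
  have dYY: "dY Y = 1" by (simp add: dY_def Y_def pderiv_pCons)
  have dYm': "dY (monom 1 (Suc b)) = m + Y * dY m"
    by (simp add: m' dY_mult dYY)
  have "weyl_act (weyl_q ^ Suc b) h = Y * (m * h - dY m * dX h + E) - dX (m * h - dY m * dX h + E)"
    by (simp only: power_Suc weyl_act_mult weyl_act_simps gen_act.simps act Y)
  then have "weyl_act (weyl_q ^ Suc b) h - (monom 1 (Suc b) * h - dY (monom 1 (Suc b)) * dX h) =
      dY m * dX (dX h) + (pCons 0 E - dX E)"
    unfolding dYm' unfolding m' Y dX_add dX_diff dX_mult dXm by (simp add: algebra_simps)
  moreover have "weights_in \<rho> \<sigma> {..s + \<sigma> * real (Suc b) - 2 * (\<rho> + \<sigma>)} (dY m * dX (dX h))"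
  proof (rule weights_in_mult)
    show "weights_in \<rho> \<sigma> {\<sigma> * real b - \<sigma>} (dY m)"
      by (rule weights_in_dY[of _ _ "{\<sigma> * real b}"])
        (use weights_in_monom[of \<rho> 0 \<sigma> b _ 1] in \<open>auto simp: m_def\<close>)
    show "weights_in \<rho> \<sigma> {..s - 2 * \<rho>} (dX (dX h))"
      by (rule weights_in_dX[OF weights_in_dX[OF assms(1), of "{..s - \<rho>}"]]) auto
  qed (auto simp: algebra_simps)
  moreover have "weights_in \<rho> \<sigma> {..s + \<sigma> * real (Suc b) - 2 * (\<rho> + \<sigma>)} (pCons 0 E - dX E)"
    using assms(2)
    by (intro weights_in_diff weights_in_pCons_0[OF E] weights_in_dX[OF E]) (auto simp: algebra_simps)
  ultimately show ?case by (simp add: weights_in_add)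
qed

lemma Phi_mult_expansion:
  assumes "weights_in \<rho> \<sigma> {..r} (Phi z)" "weights_in \<rho> \<sigma> {..s} (Phi w)" "\<rho> + \<sigma> > 0"
  shows "weights_in \<rho> \<sigma> {..r + s - 2 * (\<rho> + \<sigma>)}
    (Phi (z * w) - (Phi z * Phi w - dY (Phi z) * dX (Phi w)))"
proof -
  define h where "h = Phi w"
  have h: "weights_in \<rho> \<sigma> {..s} h" using assms by (simp add: h_def)
  have "weights_in \<rho> \<sigma> {..r + s - 2 * (\<rho> + \<sigma>)}
      (weyl_act (normal_order f) h - (f * h - dY f * dX h))" if "weights_in \<rho> \<sigma> {..r} f" for f
    using that
  proof (induction rule: weights_in_induct)
    case zero
    show ?case by (simp add: dY_def)
  next
    case (add f c i j)
    let ?m = "monom (monom c i) j"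
    let ?E = "weyl_act (weyl_q ^ j) h - (monom 1 j * h - dY (monom 1 j) * dX h)"
    have p: "weyl_act (weyl_p ^ i) g = smult (monom 1 i) g" for g :: "'a poly poly"
      by (induction i) (simp_all add: weyl_act_mult smult_monom monom_Suc flip: one_pCons)
    have "weyl_act (normal_order ?m) h = smult (monom c i) (weyl_act (weyl_q ^ j) h)"
      by (simp add: normal_order_monom weyl_act_mult p smult_monom)
    moreover have "?m = smult (monom c i) (monom 1 j)" by (simp add: smult_monom)
    moreover have "dY ?m = smult (monom c i) (dY (monom 1 j))"
      by (simp only: dY_def pderiv_smult calculation(2))
    ultimately have eq: "weyl_act (normal_order ?m) h - (?m * h - dY ?m * dX h) = smult (monom c i) ?E"
      by (simp only: mult_smult_left smult_diff_right)
    have "weights_in \<rho> \<sigma> {..r + s - 2 * (\<rho> + \<sigma>)} (monom (monom c i) 0 * ?E)"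
      by (rule weights_in_mult[OF weights_in_monom[OF singletonI] weyl_act_q_power[OF h assms(3)]])
        (use add.hyps in auto)
    then have "weights_in \<rho> \<sigma> {..r + s - 2 * (\<rho> + \<sigma>)} (smult (monom c i) ?E)"
      by (simp add: monom_0)
    from weights_in_add[OF this add.IH] show ?case
      unfolding eq[symmetric] by (simp add: normal_order_add weyl_act_add dY_add algebra_simps)
  qed
  from this[OF assms(1)] show ?thesis by (simp add: Phi_mult h_def)
qed

lemma weights_in_poisson:
  assumes "weights_in \<rho> \<sigma> S f" "weights_in \<rho> \<sigma> T g"
    "\<And>s t. s \<in> S \<Longrightarrow> t \<in> T \<Longrightarrow> s + t - (\<rho> + \<sigma>) \<in> U"
  shows "weights_in \<rho> \<sigma> U (poisson f g)"
proof -
  have X: "weights_in \<rho> \<sigma> ((\<lambda>s. s - \<rho>) ` A) (dX h)" if "weights_in \<rho> \<sigma> A h" for A and h :: "'a poly poly"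
    by (rule weights_in_dX[OF that]) auto
  have Y: "weights_in \<rho> \<sigma> ((\<lambda>s. s - \<sigma>) ` A) (dY h)" if "weights_in \<rho> \<sigma> A h" for A and h :: "'a poly poly"
    by (rule weights_in_dY[OF that]) auto
  show ?thesis
    unfolding poisson_def
    by (intro weights_in_diff weights_in_mult[OF X[OF assms(1)] Y[OF assms(2)]]
        weights_in_mult[OF Y[OF assms(1)] X[OF assms(2)]])
      (use assms(3) in \<open>force simp: algebra_simps\<close>)+
qed

lemma Phi_commutator:
  assumes "weights_in \<rho> \<sigma> {..r} (Phi z)" "weights_in \<rho> \<sigma> {..s} (Phi w)" "\<rho> + \<sigma> > 0"
  shows "weights_in \<rho> \<sigma> {..r + s - 2 * (\<rho> + \<sigma>)} (Phi (commutator z w) - poisson (Phi z) (Phi w))"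
proof -
  have "Phi (commutator z w) - poisson (Phi z) (Phi w) =
      (Phi (z * w) - (Phi z * Phi w - dY (Phi z) * dX (Phi w))) -
      (Phi (w * z) - (Phi w * Phi z - dY (Phi w) * dX (Phi z)))"
    by (simp add: commutator_def poisson_def Phi_diff algebra_simps)
  then show ?thesis
    using weights_in_diff[OF Phi_mult_expansion[OF assms]
        Phi_mult_expansion[OF assms(2,1,3), unfolded add.commute[of s r]]] by simp
qed

text \<open>Here the weight is explicit and \<open>f\<close> may vanish, which makes this relation compatible with
  products by counting weights alone.\<close>

definition top_part :: "real \<Rightarrow> real \<Rightarrow> real \<Rightarrow> 'k::field poly poly \<Rightarrow> 'k poly poly \<Rightarrow> bool" where
  "top_part \<rho> \<sigma> r f F \<longleftrightarrow> weights_in \<rho> \<sigma> {r} f \<and> weights_in \<rho> \<sigma> {..<r} (F - f)"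

lemma top_partD:
  assumes "top_part \<rho> \<sigma> r f F"
  shows "weights_in \<rho> \<sigma> {r} f" "weights_in \<rho> \<sigma> {..<r} (F - f)" "weights_in \<rho> \<sigma> {..r} F"
    "weights_in \<rho> \<sigma> {..r} f"
proof -
  show 1: "weights_in \<rho> \<sigma> {r} f" "weights_in \<rho> \<sigma> {..<r} (F - f)"
    using assms by (auto simp: top_part_def)
  show 2: "weights_in \<rho> \<sigma> {..r} f" by (rule weights_in_mono[OF 1(1)]) auto
  have "weights_in \<rho> \<sigma> {..r} (F - f)" by (rule weights_in_mono[OF 1(2)]) auto
  from weights_in_add[OF this 2] show "weights_in \<rho> \<sigma> {..r} F" by simp
qed

lemma top_part_leading_form: "F \<noteq> 0 \<Longrightarrow> top_part \<rho> \<sigma> (vdeg \<rho> \<sigma> F) (leading_form \<rho> \<sigma> F) F"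
  by (simp add: top_part_def weights_in_leading_form weights_in_leading_form_diff)

lemma top_part_mult:
  assumes z: "top_part \<rho> \<sigma> r f (Phi z)" and w: "top_part \<rho> \<sigma> s g (Phi w)" and pos: "\<rho> + \<sigma> > 0"
  shows "top_part \<rho> \<sigma> (r + s) (f * g) (Phi (z * w))"
proof -
  have 1: "weights_in \<rho> \<sigma> {..<r + s} (Phi (z * w) - (Phi z * Phi w - dY (Phi z) * dX (Phi w)))"
    by (rule weights_in_mono[OF Phi_mult_expansion[OF top_partD(3)[OF z] top_partD(3)[OF w] pos]])
      (use pos in auto)
  have 2: "weights_in \<rho> \<sigma> {..<r + s} (dY (Phi z) * dX (Phi w))"
    by (rule weights_in_mult[OF weights_in_dY[OF top_partD(3)[OF z], of "{..r - \<sigma>}"]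
          weights_in_dX[OF top_partD(3)[OF w], of "{..s - \<rho>}"]]) (use pos in auto)
  have 3: "weights_in \<rho> \<sigma> {..<r + s} ((Phi z - f) * Phi w)"
    by (rule weights_in_mult[OF top_partD(2)[OF z] top_partD(3)[OF w]]) auto
  have 4: "weights_in \<rho> \<sigma> {..<r + s} (f * (Phi w - g))"
    by (rule weights_in_mult[OF top_partD(4)[OF z] top_partD(2)[OF w]]) auto
  have "weights_in \<rho> \<sigma> {..<r + s} (Phi (z * w) - f * g)"
    using weights_in_add[OF weights_in_add[OF weights_in_diff[OF 1 2] 3] 4]
    by (simp add: algebra_simps)
  moreover have "weights_in \<rho> \<sigma> {r + s} (f * g)"
    by (rule weights_in_mult[OF top_partD(1)[OF z] top_partD(1)[OF w]]) auto
  ultimately show ?thesis by (simp add: top_part_def)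
qed

lemma weights_in_1: "0 \<in> S \<Longrightarrow> weights_in \<rho> \<sigma> S 1"
  using weights_in_monom[of \<rho> 0 \<sigma> 0 S 1] by simp

text \<open>As \<open>K[X,Y]\<close> is the associated graded ring, an expression \<open>c f\<^sup>k\<close> in leading forms lifts to
  \<open>c z\<^sup>k\<close>; this is what makes the descent possible.\<close>

lemma top_part_power:
  assumes "top_part \<rho> \<sigma> r f (Phi z)" "\<rho> + \<sigma> > 0"
  shows "top_part \<rho> \<sigma> (real k * r) (f ^ k) (Phi (z ^ k))"
proof (induction k)
  case 0
  show ?case by (simp add: top_part_def weights_in_1)
next
  case (Suc k)
  from top_part_mult[OF assms(1) this assms(2)] show ?case by (simp add: algebra_simps)
qed

text \<open>Compare \<open>1 = \<Phi> [z, w]\<close> with \<open>{f, g}\<close>, which is its part of weight \<open>d = r + s - (\<rho> + \<sigma>)\<close>: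
  all weights of \<open>1\<close> are \<open>0\<close>, so the part vanishes for \<open>d > 0\<close>, is \<open>1\<close> for \<open>d = 0\<close>, and
  \<open>d < 0\<close> cannot occur.\<close>

lemma poisson_top_parts:
  assumes z: "top_part \<rho> \<sigma> r f (Phi z)" and w: "top_part \<rho> \<sigma> s g (Phi w)"
    and pos: "\<rho> + \<sigma> > 0" and comm: "commutator z w = 1"
  shows "r + s = \<rho> + \<sigma> \<and> poisson f g = 1 \<or> r + s > \<rho> + \<sigma> \<and> poisson f g = 0"
proof -
  define d where "d = r + s - (\<rho> + \<sigma>)"
  have "weights_in \<rho> \<sigma> {..<d} (1 - poisson (Phi z) (Phi w))"
    using Phi_commutator[OF top_partD(3)[OF z] top_partD(3)[OF w] pos] unfolding comm Phi_1
    by (rule weights_in_mono) (use pos in \<open>auto simp: d_def\<close>)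
  moreover have "weights_in \<rho> \<sigma> {..<d} (poisson (Phi z - f) (Phi w))"
    by (rule weights_in_poisson[OF top_partD(2)[OF z] top_partD(3)[OF w]]) (auto simp: d_def)
  moreover have "weights_in \<rho> \<sigma> {..<d} (poisson f (Phi w - g))"
    by (rule weights_in_poisson[OF top_partD(4)[OF z] top_partD(2)[OF w]]) (auto simp: d_def)
  ultimately have "weights_in \<rho> \<sigma> {..<d}
      ((1 - poisson (Phi z) (Phi w)) + poisson (Phi z - f) (Phi w) + poisson f (Phi w - g))"
    by (intro weights_in_add)
  moreover have "poisson f g = poisson (Phi z) (Phi w) - poisson (Phi z - f) (Phi w) - poisson f (Phi w - g)"
    by (simp add: poisson_def dX_diff dY_def pderiv_diff algebra_simps)
  ultimately have low: "weights_in \<rho> \<sigma> {..<d} (1 - poisson f g)"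
    by (simp only:) (simp add: algebra_simps)
  have hom: "weights_in \<rho> \<sigma> {d} (poisson f g)"
    by (rule weights_in_poisson[OF top_partD(1)[OF z] top_partD(1)[OF w]]) (auto simp: d_def)
  have one: "weights_in \<rho> \<sigma> {0} (1 :: 'a poly poly)" by (simp add: weights_in_1)
  consider "d < 0" | "d = 0" | "d > 0" by linarith
  then show ?thesis
  proof cases
    case 1
    have "weights_in \<rho> \<sigma> {..d} (1 - poisson f g)" "weights_in \<rho> \<sigma> {..d} (poisson f g)"
      by (rule weights_in_mono[OF low] weights_in_mono[OF hom]; auto)+
    from weights_in_add[OF this] have "weights_in \<rho> \<sigma> {..d} (1 :: 'a poly poly)" by simp
    from weights_in_disjoint[OF one this] 1 show ?thesis by simp
  next
    case 2
    with weights_in_diff[OF one] hom have "weights_in \<rho> \<sigma> {0} (1 - poisson f g)" by blast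
    from weights_in_disjoint[OF this low] 2 show ?thesis by (simp add: d_def)
  next
    case 3
    have "weights_in \<rho> \<sigma> {..<d} (1 :: 'a poly poly)" by (rule weights_in_1) (use 3 in simp)
    from weights_in_diff[OF this low] have "weights_in \<rho> \<sigma> {..<d} (poisson f g)" by simp
    from weights_in_disjoint[OF hom this] 3 show ?thesis by (simp add: d_def)
  qed
qed

section \<open>Coefficients of Poisson products\<close>

text \<open>Multiplied by \<open>X Y\<close>, the Poisson product is built from the Euler operators \<open>X \<partial>/\<partial>X\<close> and
  \<open>Y \<partial>/\<partial>Y\<close>, which are diagonal on monomials. So \<open>X\<^sup>i Y\<^sup>j\<close> and \<open>X\<^sup>k Y\<^sup>l\<close> contribute the
  determinant \<open>i l - j k\<close>, and no exponent is shifted.\<close>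

lemma cf_XY_poisson:
  "cf (pCons 0 (smult [:0, 1:] (poisson f g))) m n =
    (\<Sum>j\<le>n. \<Sum>i\<le>m. (of_nat i * of_nat (n - j) - of_nat j * of_nat (m - i)) *
      (cf f i j * cf g (m - i) (n - j)))"
proof -
  define X_dX where "X_dX h = smult [:0, 1:] (dX h)" for h :: "'a poly poly"
  define Y_dY where "Y_dY h = pCons 0 (dY h)" for h :: "'a poly poly"
  have X_dX: "cf (X_dX h) i j = of_nat i * cf h i j" for h i j
    by (cases i) (simp_all add: X_dX_def cf_dX del: of_nat_Suc)
  have Y_dY: "cf (Y_dY h) i j = of_nat j * cf h i j" for h i j
    by (cases j) (simp_all add: Y_dY_def cf_dY del: of_nat_Suc)
  have "pCons 0 (smult [:0, 1:] (poisson f g)) = X_dX f * Y_dY g - Y_dY f * X_dX g"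
    by (simp add: X_dX_def Y_dY_def poisson_def smult_diff_right)
  also have "cf \<dots> m n = (\<Sum>j\<le>n. \<Sum>i\<le>m. cf (X_dX f) i j * cf (Y_dY g) (m - i) (n - j)) -
      (\<Sum>j\<le>n. \<Sum>i\<le>m. cf (Y_dY f) i j * cf (X_dX g) (m - i) (n - j))"
    by (simp only: coeff_diff cf_mult)
  finally show ?thesis
    by (simp add: X_dX Y_dY sum_subtractf[symmetric] algebra_simps)
qed

lemma cf_XY: "cf (pCons 0 (smult [:0, 1:] 1)) m n = (if m = 1 \<and> n = 1 then 1 else 0)"
  by (simp add: coeff_pCons split: nat.split)

lemma poisson_eq_1_linear_part:
  assumes "poisson f g = 1"
  shows "cf f 1 0 * cf g 0 1 - cf f 0 1 * cf g 1 0 = 1"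
proof -
  have "(1 :: 'a) = cf (pCons 0 (smult [:0, 1:] (poisson f g))) 1 1"
    unfolding assms cf_XY by simp
  also have "\<dots> = cf f 1 0 * cf g 0 1 - cf f 0 1 * cf g 1 0"
    unfolding cf_XY_poisson by simp
  finally show ?thesis by simp
qed

lemma finite_ex_max:
  fixes h :: "'a \<Rightarrow> 'b::linorder"
  assumes "finite A" "A \<noteq> {}"
  obtains x where "x \<in> A" "\<And>y. y \<in> A \<Longrightarrow> h y \<le> h x"
proof -
  have "Max (h ` A) \<in> h ` A" using assms by simp
  then obtain x where "x \<in> A" "Max (h ` A) = h x" by auto
  with assms show ?thesis by (metis Max_ge finite_imageI imageI that)
qed

text \<open>Take the monomials \<open>X\<^sup>i Y\<^sup>j\<close> of \<open>f\<close> and \<open>X\<^sup>k Y\<^sup>l\<close> of \<open>g\<close> of largest total degree. As \<open>\<rho> \<noteq> \<sigma>\<close>,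
  weight and total degree determine a monomial, so only this pair contributes to the coefficient of
  \<open>X\<^bsup>i+k\<^esup> Y\<^bsup>j+l\<^esup>\<close> in \<open>X Y {f, g}\<close>. Its determinant \<open>i l - j k\<close> is nonzero, because \<open>(i, j)\<close>
  is a nonzero vector of weight \<open>0\<close> and hence not proportional to the vector \<open>(k, l)\<close> of weight
  \<open>s > 0\<close>. As \<open>{f, g}\<close> is \<open>0\<close> or \<open>1\<close>, this forces \<open>(i + k, j + l) = (1, 1)\<close>; and
  \<open>(i, j) = (1, 1)\<close> is excluded, since \<open>(k, l) = (0, 0)\<close> does not have weight \<open>s\<close>.\<close>

lemma weight_0_partner:
  fixes f g :: "'k::field_char_0 poly poly"
  assumes f: "weights_in \<rho> \<sigma> {0} f" and g: "weights_in \<rho> \<sigma> {s} g" "g \<noteq> 0" "s > 0"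
    and dir: "\<rho> \<noteq> \<sigma>"
    and nonconst: "cf f a b \<noteq> 0" "a + b > 0"
    and poisson: "poisson f g = 0 \<or> poisson f g = 1"
  shows "\<rho> = 0 \<or> \<sigma> = 0" "cf f i j \<noteq> 0 \<Longrightarrow> i + j \<le> 1"
proof -
  obtain x where x: "x \<in> supp f" "\<And>y. y \<in> supp f \<Longrightarrow> fst y + snd y \<le> fst x + snd x"
    by (rule finite_ex_max[of "supp f" "\<lambda>y. fst y + snd y"])
      (use nonconst(1) in \<open>auto simp: supp_def finite_supp[unfolded supp_def]\<close>)
  obtain i1 j1 where "x = (i1, j1)" by (cases x)
  with x have f1: "cf f i1 j1 \<noteq> 0" and f_max: "\<And>i j. cf f i j \<noteq> 0 \<Longrightarrow> i + j \<le> i1 + j1"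
    by (auto simp: supp_def)
  obtain y where y: "y \<in> supp g" "\<And>x. x \<in> supp g \<Longrightarrow> fst x + snd x \<le> fst y + snd y"
    by (rule finite_ex_max[of "supp g" "\<lambda>y. fst y + snd y"]) (use g(2) vdeg_eq_Max(2)[of g] in auto)
  obtain k1 l1 where "y = (k1, l1)" by (cases y)
  with y have g1: "cf g k1 l1 \<noteq> 0" and g_max: "\<And>k l. cf g k l \<noteq> 0 \<Longrightarrow> k + l \<le> k1 + l1"
    by (auto simp: supp_def)
  let ?m = "i1 + k1" and ?n = "j1 + l1"
  let ?t = "\<lambda>i j. (of_nat i * of_nat (?n - j) - of_nat j * of_nat (?m - i)) *
      (cf f i j * cf g (?m - i) (?n - j))"
  have ij1: "\<rho> * real i1 + \<sigma> * real j1 = 0" using weights_inD[OF f f1] by simp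
  have kl1: "\<rho> * real k1 + \<sigma> * real l1 = s" using weights_inD[OF g(1) g1] by simp
  have single: "?t i j = (if i = i1 then if j = j1 then ?t i1 j1 else 0 else 0)"
    if "i \<le> ?m" "j \<le> ?n" for i j
  proof (cases "cf f i j \<noteq> 0 \<and> cf g (?m - i) (?n - j) \<noteq> 0")
    case True
    have "\<rho> * real i + \<sigma> * real j = 0" using weights_inD[OF f] True by simp
    moreover have "i + j = i1 + j1"
      using f_max[where i = i and j = j] g_max[where k = "?m - i" and l = "?n - j"] True that by simp
    then have "real j = real i1 + real j1 - real i" by linarith
    ultimately have "(\<rho> - \<sigma>) * (real i - real i1) = 0"
      using ij1 by (simp add: algebra_simps)
    with dir have "i = i1" by simp
    with \<open>i + j = i1 + j1\<close> show ?thesis by simp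
  next
    case False
    then show ?thesis using f1 g1 by auto
  qed
  have "cf (pCons 0 (smult [:0, 1:] (poisson f g))) ?m ?n =
      (\<Sum>j\<le>?n. \<Sum>i\<le>?m. if i = i1 then if j = j1 then ?t i1 j1 else 0 else 0)"
    unfolding cf_XY_poisson by (intro sum.cong refl single) auto
  also have "\<dots> = ?t i1 j1" by simp
  also have "\<dots> \<noteq> 0"
  proof
    assume "?t i1 j1 = 0"
    then have "of_nat (i1 * l1) = (of_nat (j1 * k1) :: 'k)" using f1 g1 by simp
    then have eq: "real i1 * real l1 = real j1 * real k1"
      by (metis of_nat_eq_iff of_nat_mult)
    have "real i1 * s = real k1 * (\<rho> * real i1 + \<sigma> * real j1)"
      using eq by (simp add: kl1[symmetric] algebra_simps)
    moreover have "real j1 * s = real l1 * (\<rho> * real i1 + \<sigma> * real j1)"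
      using eq by (simp add: kl1[symmetric] algebra_simps)
    ultimately have "real i1 * s = 0" "real j1 * s = 0" by (simp_all only: ij1 mult_zero_right)
    then have "i1 = 0" "j1 = 0" using g(3) by simp_all
    with f_max[OF nonconst(1)] nonconst(2) show False by simp
  qed
  finally have nz: "cf (pCons 0 (smult [:0, 1:] (poisson f g))) ?m ?n \<noteq> 0" .
  then have "poisson f g \<noteq> 0" by auto
  with poisson nz have mn: "?m = 1" "?n = 1" unfolding cf_XY by (metis cf_XY)+
  have sum: "i1 + j1 = 1"
  proof (rule ccontr)
    assume "i1 + j1 \<noteq> 1"
    moreover have "i1 + j1 > 0" using f_max[OF nonconst(1)] nonconst(2) by linarith
    ultimately have "k1 = 0" "l1 = 0" using mn by linarith+
    with kl1 g(3) show False by simp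
  qed
  with ij1 show "\<rho> = 0 \<or> \<sigma> = 0" by (cases i1) auto
  show "i + j \<le> 1" if "cf f i j \<noteq> 0" using f_max[OF that] sum by simp
qed

lemma vdeg_eqI:
  assumes "weights_in \<rho> \<sigma> {..r} f" "cf f i j \<noteq> 0" "\<rho> * real i + \<sigma> * real j = r"
  shows "vdeg \<rho> \<sigma> f = r"
proof -
  have nz: "f \<noteq> 0" using assms(2) by auto
  have "r \<le> vdeg \<rho> \<sigma> f"
    using weights_inD[OF weights_le_vdeg[OF nz] assms(2), of \<rho> \<sigma>] assms(3) by simp
  moreover obtain m n where "cf (leading_form \<rho> \<sigma> f) m n \<noteq> 0"
    using leading_form_nonzero[OF nz] cf_eqI[of "leading_form \<rho> \<sigma> f" 0] by (metis coeff_0)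
  then have "vdeg \<rho> \<sigma> f \<le> r"
    using weights_inD[OF assms(1), where i = m and j = n] by (simp add: cf_leading_form split: if_splits)
  ultimately show ?thesis by simp
qed

lemma commutator_eq_1_not_const:
  assumes "commutator z w = 1"
  obtains i j where "cf (Phi z) i j \<noteq> 0" "i + j > 0"
proof -
  have False if const: "\<And>i j. cf (Phi z) i j \<noteq> 0 \<Longrightarrow> i + j = 0"
  proof -
    have "Phi z = monom (monom (cf (Phi z) 0 0) 0) 0"
      by (rule cf_eqI) (use const in \<open>force simp: coeff_monom\<close>)
    then have "z = normal_order (monom (monom (cf (Phi z) 0 0) 0) 0)" by (metis normal_order_Phi)
    then have "z = weyl_const (cf (Phi z) 0 0)" by (simp add: normal_order_monom)
    then have "z * w = w * z" by (metis weyl_const_commute)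
    with assms show False by (simp add: commutator_def)
  qed
  with that show ?thesis by blast
qed

lemma commutator_eq_1_nonzero:
  assumes "commutator z w = 1"
  shows "Phi w \<noteq> 0"
  using assms by (metis Phi_0 commutator_def diff_self mult_zero_left mult_zero_right normal_order_Phi zero_neq_one)

text \<open>The direction is moved to \<open>(\<rho> + t, \<sigma> + t)\<close> with the least \<open>t \<ge> 0\<close> for which a nonconstant
  monomial of \<open>z\<close> gets weight \<open>0\<close>; no weight is positive yet, and the sum of the two weights has
  only grown. By \<open>weight_0_partner\<close> one of the new weights is \<open>0\<close> and the leading form
  is affine; as the other weight is positive, there is nothing below this leading form.\<close>

lemma affine_if_weights_nonpos:
  fixes z w :: "'k::field_char_0 weyl"
  assumes weights: "weights_in \<rho> \<sigma> {..0} (Phi z)" and pos: "\<rho> + \<sigma> > 0" and comm: "commutator z w = 1"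
  shows "(\<forall>i j. cf (Phi z) i j \<noteq> 0 \<longrightarrow> i \<le> 1 \<and> j = 0) \<or>
    (\<forall>i j. cf (Phi z) i j \<noteq> 0 \<longrightarrow> i = 0 \<and> j \<le> 1)"
proof -
  define F where "F = Phi z"
  define h where "h = (\<lambda>(i, j). (\<rho> * real i + \<sigma> * real j) / (real i + real j))"
  let ?A = "{(i, j) \<in> supp F. i + j > 0}"
  obtain a b where ab: "cf F a b \<noteq> 0" "a + b > 0"
    using commutator_eq_1_not_const[OF comm] unfolding F_def by blast
  have "finite ?A" by (rule finite_subset[OF _ finite_supp[of F]]) auto
  moreover have "?A \<noteq> {}" using ab by (auto simp: supp_def)
  ultimately obtain x where x: "x \<in> ?A" "\<And>y. y \<in> ?A \<Longrightarrow> h y \<le> h x"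
    by (rule finite_ex_max[where h = h]) (rule that)
  obtain i0 j0 where ij0: "x = (i0, j0)" by (cases x)
  \<comment> \<open>\<open>h\<close> is the weight per unit of degree; the shift by \<open>t\<close> adds \<open>t\<close> to it, so that its maximum becomes \<open>0\<close>.\<close>
  define t where "t = - h (i0, j0)"
  have nz: "cf F i0 j0 \<noteq> 0" "i0 + j0 > 0" using x(1) by (auto simp: ij0 supp_def)
  have "real (i0 + j0) > 0" using nz(2) by (simp only: of_nat_0_less_iff)
  then have pos0: "real i0 + real j0 > 0" by (simp only: of_nat_add)
  have t0: "\<rho> * real i0 + \<sigma> * real j0 \<le> 0"
    using weights_inD[OF weights, folded F_def, OF nz(1)] by simp
  then have "t \<ge> 0" using pos0 by (simp add: t_def h_def divide_le_0_iff)
  define \<rho>' \<sigma>' where "\<rho>' = \<rho> + t" and "\<sigma>' = \<sigma> + t"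
  have pos': "\<rho>' + \<sigma>' > 0" using pos \<open>t \<ge> 0\<close> by (simp add: \<rho>'_def \<sigma>'_def)
  have weights': "weights_in \<rho>' \<sigma>' {..0} F"
    unfolding weights_in_def
  proof (intro allI impI)
    fix i j
    assume ij: "cf F i j \<noteq> 0"
    show "\<rho>' * real i + \<sigma>' * real j \<in> {..0}"
    proof (cases "i + j > 0")
      case True
      then have "h (i, j) \<le> - t" using x(2)[of "(i, j)"] ij by (simp add: t_def ij0 supp_def)
      moreover have "real (i + j) > 0" using True by (simp only: of_nat_0_less_iff)
      then have "real i + real j > 0" by (simp only: of_nat_add)
      ultimately have "\<rho> * real i + \<sigma> * real j \<le> - t * (real i + real j)"
        by (simp add: h_def pos_divide_le_eq)
      then show ?thesis by (simp add: \<rho>'_def \<sigma>'_def algebra_simps)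
    qed auto
  qed
  have "t * (real i0 + real j0) = - (\<rho> * real i0 + \<sigma> * real j0)"
    using pos0 by (simp add: t_def h_def)
  then have zero: "\<rho>' * real i0 + \<sigma>' * real j0 = 0" by (simp add: \<rho>'_def \<sigma>'_def algebra_simps)
  define f where "f = leading_form \<rho>' \<sigma>' F"
  have v: "vdeg \<rho>' \<sigma>' F = 0" by (rule vdeg_eqI[OF weights' nz(1) zero])
  have "F \<noteq> 0" using nz by auto
  from top_part_leading_form[OF this, of \<rho>' \<sigma>'] have tf: "top_part \<rho>' \<sigma>' 0 f (Phi z)"
    by (simp only: v f_def[symmetric] F_def[symmetric])
  have f0: "cf f i0 j0 \<noteq> 0" using nz zero by (simp add: f_def cf_leading_form v)
  define g where "g = leading_form \<rho>' \<sigma>' (Phi w)"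
  define s where "s = vdeg \<rho>' \<sigma>' (Phi w)"
  have w: "Phi w \<noteq> 0" by (rule commutator_eq_1_nonzero[OF comm])
  have tg: "top_part \<rho>' \<sigma>' s g (Phi w)" unfolding s_def g_def by (rule top_part_leading_form[OF w])
  from poisson_top_parts[OF tf tg pos' comm]
  have s: "s > 0" and poisson: "poisson f g = 0 \<or> poisson f g = 1" using pos' by auto
  have dir: "\<rho>' \<noteq> \<sigma>'"
  proof
    assume "\<rho>' = \<sigma>'"
    with zero have "\<sigma>' * (real i0 + real j0) = 0" by (simp add: algebra_simps)
    with pos0 pos' \<open>\<rho>' = \<sigma>'\<close> show False by simp
  qed
  have g: "g \<noteq> 0" unfolding g_def by (rule leading_form_nonzero[OF w])
  note partner = weight_0_partner[OF top_partD(1)[OF tf] top_partD(1)[OF tg] g s dir f0 nz(2) poisson]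
  from partner(1) show ?thesis
  proof
    \<comment> \<open>Weights at most \<open>0\<close> now exclude \<open>Y\<close>, so all of \<open>F\<close> has weight \<open>0\<close>, that is, \<open>F\<close> equals \<open>f\<close>.\<close>
    assume "\<rho>' = 0"
    have "i \<le> 1 \<and> j = 0" if "cf F i j \<noteq> 0" for i j
    proof -
      have "\<sigma>' * real j \<le> 0" using weights_inD[OF weights' that] \<open>\<rho>' = 0\<close> by simp
      then have "j = 0" using pos' \<open>\<rho>' = 0\<close> by (simp add: mult_le_0_iff)
      moreover have "cf f i j \<noteq> 0"
        unfolding f_def cf_leading_form v using that \<open>j = 0\<close> \<open>\<rho>' = 0\<close> by simp
      from partner(2)[OF this] have "i \<le> 1" by simp
      ultimately show ?thesis by simp
    qed
    then show ?thesis by (simp add: F_def)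
  next
    assume "\<sigma>' = 0"
    have "i = 0 \<and> j \<le> 1" if "cf F i j \<noteq> 0" for i j
    proof -
      have "\<rho>' * real i \<le> 0" using weights_inD[OF weights' that] \<open>\<sigma>' = 0\<close> by simp
      then have "i = 0" using pos' \<open>\<sigma>' = 0\<close> by (simp add: mult_le_0_iff)
      moreover have "cf f i j \<noteq> 0"
        unfolding f_def cf_leading_form v using that \<open>i = 0\<close> \<open>\<sigma>' = 0\<close> by simp
      from partner(2)[OF this] have "j \<le> 1" by simp
      ultimately show ?thesis by simp
    qed
    then show ?thesis by (simp add: F_def)
  qed
qed

section \<open>Subalgebras\<close>

lemma is_subalgebraD:
  assumes "is_subalgebra B"
  shows "weyl_const c \<in> B" "x \<in> B \<Longrightarrow> y \<in> B \<Longrightarrow> x + y \<in> B" "x \<in> B \<Longrightarrow> y \<in> B \<Longrightarrow> x * y \<in> B"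
  using assms by (auto simp: is_subalgebra_def)

lemma weyl_const_uminus: "weyl_const (- c) = - weyl_const c"
  using weyl_const_add[of c "- c"] by (simp add: minus_unique)

lemma subalgebra_uminus:
  assumes "is_subalgebra B" "x \<in> B"
  shows "- x \<in> B"
  using is_subalgebraD(3)[OF assms(1) is_subalgebraD(1)[OF assms(1), of "- 1"] assms(2)]
  by (simp add: weyl_const_uminus)

lemma subalgebra_diff: "is_subalgebra B \<Longrightarrow> x \<in> B \<Longrightarrow> y \<in> B \<Longrightarrow> x - y \<in> B"
  using is_subalgebraD(2)[of B x "- y"] subalgebra_uminus[of B y] by simp

lemma subalgebra_power:
  assumes "is_subalgebra B" "x \<in> B"
  shows "x ^ n \<in> B"
  using is_subalgebraD(1)[OF assms(1), of 1] is_subalgebraD(3)[OF assms(1) assms(2)]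
  by (induction n) auto

lemma subalgebra_sum: "is_subalgebra B \<Longrightarrow> (\<And>x. x \<in> A \<Longrightarrow> F x \<in> B) \<Longrightarrow> sum F A \<in> B"
  using is_subalgebraD(1)[of B 0]
  by (induction A rule: infinite_finite_induct) (auto intro: is_subalgebraD)

lemma subalgebra_normal_order:
  assumes "is_subalgebra B" "\<And>i j. cf f i j \<noteq> 0 \<Longrightarrow> weyl_p ^ i \<in> B \<and> weyl_q ^ j \<in> B"
  shows "normal_order f \<in> B"
  unfolding normal_order_def
proof (intro subalgebra_sum[OF assms(1)])
  fix x
  assume "x \<in> supp f"
  then obtain i j where "x = (i, j)" "cf f i j \<noteq> 0" by (auto simp: supp_def)
  with assms show "(case x of (i, j) \<Rightarrow> weyl_const (cf f i j) * weyl_p ^ i * weyl_q ^ j) \<in> B"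
    by (auto intro!: is_subalgebraD)
qed

lemma subalgebra_eq_UNIV:
  assumes "is_subalgebra B" "weyl_p \<in> B" "weyl_q \<in> B"
  shows "B = UNIV"
proof -
  have "normal_order (Phi x) \<in> B" for x
    using assms by (intro subalgebra_normal_order) (auto intro: subalgebra_power)
  then show ?thesis by auto
qed

lemma commutator_add_left: "commutator (x + y) w = commutator x w + commutator y w"
  by (simp add: commutator_def algebra_simps)

lemma commutator_add_right: "commutator w (x + y) = commutator w x + commutator w y"
  by (simp add: commutator_def algebra_simps)

lemma commutator_const_left: "commutator (weyl_const c * x) w = weyl_const c * commutator x w"
  by (simp add: commutator_def algebra_simps weyl_const_commute[of c w] flip: mult.assoc)

lemma commutator_const [simp]: "commutator (weyl_const c) w = 0"
  by (simp add: commutator_def weyl_const_commute)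

lemma normal_order_pCons_0: "normal_order (pCons 0 f) = normal_order f * weyl_q"
proof (induction f rule: poly_poly_induct)
  case (add f c i j)
  have "pCons 0 (monom (monom c i) j + f) = monom (monom c i) (Suc j) + pCons 0 f"
    by (simp add: monom_Suc)
  with add show ?case
    by (simp add: normal_order_add normal_order_monom distrib_right mult.assoc power_commutes
        del: add_pCons)
qed simp

lemma commutator_q: "commutator z weyl_q = normal_order (dX (Phi z))"
  using normal_order_gen_act(2)[of "Phi z"] normal_order_pCons_0[of "Phi z"]
  by (simp add: commutator_def normal_order_diff algebra_simps)

lemma p_q_power: "weyl_p * weyl_q ^ j = weyl_q ^ j * weyl_p + of_nat j * weyl_q ^ (j - 1)"
proof (induction j)
  case (Suc j)
  have pq: "weyl_p * weyl_q = weyl_q * weyl_p + (1 :: 'a weyl)"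
    using commutator_p_q[where 'k = 'a] by (simp add: commutator_def algebra_simps)
  have "weyl_p * weyl_q ^ Suc j = (weyl_p * weyl_q) * (weyl_q ^ j :: 'a weyl)"
    by (simp add: mult.assoc)
  also have "\<dots> = weyl_q * (weyl_p * weyl_q ^ j) + weyl_q ^ j"
    by (simp add: pq algebra_simps)
  also have "\<dots> = weyl_q ^ Suc j * weyl_p + (weyl_q * of_nat j * weyl_q ^ (j - 1) + weyl_q ^ j)"
    by (simp add: Suc algebra_simps)
  also have "weyl_q * of_nat j * weyl_q ^ (j - 1) = (of_nat j * weyl_q ^ j :: 'a weyl)"
    by (cases j) (simp_all add: mult.assoc mult_of_nat_commute flip: of_nat_Suc)
  finally show ?case by (simp add: algebra_simps)
qed simp

lemma commutator_p_normal_order: "commutator weyl_p (normal_order f) = normal_order (dY f)"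
proof (induction f rule: poly_poly_induct)
  case zero
  show ?case by (simp add: commutator_def dY_def)
next
  case (add f c i j)
  have "dY (monom (monom c i) j) = monom (monom (of_nat j * c) i) (j - 1)"
    by (cases j) (auto intro!: cf_eqI simp: cf_dY coeff_monom simp del: of_nat_Suc)
  then have "normal_order (dY (monom (monom c i) j)) =
      weyl_const c * (of_nat j * (weyl_p ^ i * weyl_q ^ (j - 1)))"
    by (simp add: normal_order_monom mult.commute[of "of_nat j"] weyl_const_mult weyl_const_of_nat
        mult.assoc)
  moreover have "commutator weyl_p (weyl_const c * (weyl_p ^ i * weyl_q ^ j)) =
      weyl_const c * (weyl_p ^ i * (weyl_p * weyl_q ^ j - weyl_q ^ j * weyl_p))"
  proof -
    have "weyl_p * (weyl_const c * x) = weyl_const c * (weyl_p * x)" for x :: "'a weyl"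
      by (metis mult.assoc weyl_const_commute)
    moreover have "weyl_p * (weyl_p ^ i * x) = weyl_p ^ i * (weyl_p * x)" for x :: "'a weyl"
      by (simp add: power_commutes flip: mult.assoc)
    ultimately show ?thesis by (simp add: commutator_def algebra_simps)
  qed
  moreover have "weyl_p ^ i * (of_nat j * x) = of_nat j * (weyl_p ^ i * x)" for x :: "'a weyl"
    by (metis mult.assoc mult_of_nat_commute)
  ultimately have "commutator weyl_p (normal_order (monom (monom c i) j)) =
      normal_order (dY (monom (monom c i) j))"
    by (simp add: normal_order_monom p_q_power mult.assoc)
  with add show ?case by (simp add: normal_order_add dY_add commutator_add_right)
qed

lemma commutator_p: "commutator weyl_p z = normal_order (dY (Phi z))"
  using commutator_p_normal_order[of "Phi z"] by simp

lemma weyl_const_cancel: "a \<noteq> 0 \<Longrightarrow> weyl_const (inverse a) * (weyl_const a * x) = x"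
  by (simp flip: mult.assoc weyl_const_mult)

lemma Phi_const: "Phi (weyl_const c) = monom (monom c 0) 0"
  using Phi_basis[of 0 0] Phi_scale[of c 1] by (simp add: smult_monom monom_0)

text \<open>With \<open>z = a p + e\<close>, the equation \<open>[z, w] = 1\<close> says that \<open>\<Phi> w\<close> has \<open>Y\<close>-derivative \<open>1/a\<close>. In
  characteristic \<open>0\<close> this leaves \<open>w = q/a + h(p)\<close>.\<close>

lemma subalgebra_affine_p:
  fixes z w :: "'k::field_char_0 weyl"
  assumes B: "is_subalgebra B" "z \<in> B" "w \<in> B" and comm: "commutator z w = 1"
    and affine: "\<And>i j. cf (Phi z) i j \<noteq> 0 \<Longrightarrow> i \<le> 1 \<and> j = 0"
  shows "weyl_p \<in> B \<and> weyl_q \<in> B"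
proof -
  define a where "a = cf (Phi z) 1 0"
  define e where "e = cf (Phi z) 0 0"
  have "Phi z = monom (monom a 1) 0 + monom (monom e 0) 0"
    by (rule cf_eqI) (use affine in \<open>force simp: coeff_monom a_def e_def le_Suc_eq\<close>)
  then have z: "z = weyl_const a * weyl_p + weyl_const e"
    by (metis (no_types, lifting) normal_order_Phi normal_order_add normal_order_monom
        power_0 power_one_right mult.right_neutral)
  with comm have comm': "weyl_const a * commutator weyl_p w = 1"
    by (simp add: commutator_add_left commutator_const_left)
  then have "a \<noteq> 0" by auto
  from weyl_const_cancel[OF this, of weyl_p] have "weyl_p = weyl_const (inverse a) * (z - weyl_const e)"
    by (simp add: z)
  with B have p: "weyl_p \<in> B" by (metis is_subalgebraD(1,3) subalgebra_diff)
  have "commutator weyl_p w = weyl_const (inverse a)"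
    using weyl_const_cancel[OF \<open>a \<noteq> 0\<close>, of "commutator weyl_p w"] by (simp add: comm')
  then have dY: "dY (Phi w) = monom (monom (inverse a) 0) 0"
    by (metis Phi_const Phi_normal_order commutator_p)
  define h where "h = Phi w - monom (monom (inverse a) 0) 1"
  have h: "j = 0" if "cf h i j \<noteq> 0" for i j
  proof (cases j)
    case (Suc n)
    from dY have "of_nat (Suc n) * cf (Phi w) i j = cf (monom (monom (inverse a) 0) 0) i n"
      unfolding Suc by (simp only: cf_dY[symmetric])
    with that show ?thesis
      by (cases "n = 0")
        (simp add: h_def Suc coeff_monom split: if_splits,
          simp add: h_def Suc coeff_monom del: of_nat_Suc split: if_splits)
  qed
  have "normal_order h \<in> B"
    by (rule subalgebra_normal_order[OF B(1)])
      (use is_subalgebraD(1)[OF B(1), of 1] p in \<open>auto intro: subalgebra_power[OF B(1)] dest!: h\<close>)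
  moreover have "normal_order h = w - weyl_const (inverse a) * weyl_q"
    by (simp add: h_def normal_order_diff normal_order_monom)
  then have "weyl_q = weyl_const a * (w - normal_order h)"
    using weyl_const_cancel[of "inverse a" weyl_q] \<open>a \<noteq> 0\<close> by simp
  ultimately have "weyl_q \<in> B"
    using B by (metis is_subalgebraD(1,3) subalgebra_diff)
  with p show ?thesis by simp
qed

text \<open>The mirror image: here \<open>z = a q + e\<close>, and \<open>w = h(q) - p/a\<close>.\<close>

lemma subalgebra_affine_q:
  fixes z w :: "'k::field_char_0 weyl"
  assumes B: "is_subalgebra B" "z \<in> B" "w \<in> B" and comm: "commutator z w = 1"
    and affine: "\<And>i j. cf (Phi z) i j \<noteq> 0 \<Longrightarrow> i = 0 \<and> j \<le> 1"
  shows "weyl_p \<in> B \<and> weyl_q \<in> B"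
proof -
  define a where "a = cf (Phi z) 0 1"
  define e where "e = cf (Phi z) 0 0"
  have "Phi z = monom (monom a 0) 1 + monom (monom e 0) 0"
    by (rule cf_eqI) (use affine in \<open>force simp: coeff_monom a_def e_def le_Suc_eq\<close>)
  then have z: "z = weyl_const a * weyl_q + weyl_const e"
    by (metis (no_types, lifting) normal_order_Phi normal_order_add normal_order_monom
        power_0 power_one_right mult.right_neutral)
  with comm have comm': "weyl_const a * commutator weyl_q w = 1"
    by (simp add: commutator_add_left commutator_const_left)
  then have "a \<noteq> 0" by auto
  from weyl_const_cancel[OF this, of weyl_q] have "weyl_q = weyl_const (inverse a) * (z - weyl_const e)"
    by (simp add: z)
  with B have q: "weyl_q \<in> B" by (metis is_subalgebraD(1,3) subalgebra_diff)
  have "commutator weyl_q w = weyl_const (inverse a)"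
    using weyl_const_cancel[OF \<open>a \<noteq> 0\<close>, of "commutator weyl_q w"] by (simp add: comm')
  then have "commutator w weyl_q = weyl_const (- inverse a)"
    by (simp add: commutator_def weyl_const_uminus algebra_simps)
  then have dX: "dX (Phi w) = monom (monom (- inverse a) 0) 0"
    by (metis Phi_const Phi_normal_order commutator_q)
  define h where "h = Phi w - monom (monom (- inverse a) 1) 0"
  have h: "i = 0" if "cf h i j \<noteq> 0" for i j
  proof (cases i)
    case (Suc n)
    from dX have "of_nat (Suc n) * cf (Phi w) i j = cf (monom (monom (- inverse a) 0) 0) n j"
      unfolding Suc by (simp only: cf_dX[symmetric])
    with that show ?thesis
      by (cases "n = 0")
        (simp add: h_def Suc coeff_monom split: if_splits,
          simp add: h_def Suc coeff_monom del: of_nat_Suc split: if_splits)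
  qed
  have "normal_order h \<in> B"
    by (rule subalgebra_normal_order[OF B(1)])
      (use is_subalgebraD(1)[OF B(1), of 1] q in \<open>auto intro: subalgebra_power[OF B(1)] dest!: h\<close>)
  moreover have "normal_order h = w + weyl_const (inverse a) * weyl_p"
    by (simp add: h_def normal_order_diff normal_order_monom weyl_const_uminus)
  then have "weyl_p = weyl_const a * (normal_order h - w)"
    using weyl_const_cancel[of "inverse a" weyl_p] \<open>a \<noteq> 0\<close> by simp
  ultimately have "weyl_p \<in> B"
    using B by (metis is_subalgebraD(1,3) subalgebra_diff)
  with q show ?thesis by simp
qed

lemma subalgebra_if_weights_nonpos:
  fixes z w :: "'k::field_char_0 weyl"
  assumes "is_subalgebra B" "z \<in> B" "w \<in> B" "commutator z w = 1"
    and "weights_in \<rho> \<sigma> {..0} (Phi z)" "\<rho> + \<sigma> > 0"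
  shows "weyl_p \<in> B \<and> weyl_q \<in> B"
  using affine_if_weights_nonpos[OF assms(5,6,4)]
    subalgebra_affine_p[OF assms(1-4)] subalgebra_affine_q[OF assms(1-4)] by blast

text \<open>For affine \<open>z\<close> and \<open>w\<close> the error term of \<open>Phi_commutator\<close> in direction \<open>(1, 1)\<close> has negative
  weight, so it vanishes and \<open>{\<Phi> z, \<Phi> w} = 1\<close>: the matrix of the linear parts has determinant
  \<open>1\<close>, and \<open>p\<close>, \<open>q\<close> are found by inverting it.\<close>

lemma subalgebra_both_affine:
  fixes z w :: "'k::field_char_0 weyl"
  assumes B: "is_subalgebra B" "z \<in> B" "w \<in> B" and comm: "commutator z w = 1"
    and affine: "\<And>i j. cf (Phi z) i j \<noteq> 0 \<Longrightarrow> i + j \<le> 1" "\<And>i j. cf (Phi w) i j \<noteq> 0 \<Longrightarrow> i + j \<le> 1"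
  shows "weyl_p \<in> B \<and> weyl_q \<in> B"
proof -
  have "weights_in 1 1 {..1} (Phi z)" "weights_in 1 1 {..1} (Phi w)"
    using affine by (force simp: weights_in_def)+
  from Phi_commutator[OF this]
  have neg: "weights_in 1 1 {..-2} (1 - poisson (Phi z) (Phi w))" by (simp add: comm)
  have "1 - poisson (Phi z) (Phi w) = 0"
  proof (rule weights_in_disjoint[OF neg])
    show "weights_in 1 1 {0..} (1 - poisson (Phi z) (Phi w))" by (simp add: weights_in_def)
  qed auto
  then have lin: "cf (Phi z) 1 0 * cf (Phi w) 0 1 - cf (Phi z) 0 1 * cf (Phi w) 1 0 = 1"
    by (intro poisson_eq_1_linear_part) simp
  define a b c d where "a = cf (Phi z) 1 0" "b = cf (Phi z) 0 1" "c = cf (Phi w) 1 0" "d = cf (Phi w) 0 1"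
  note abcd = this
  \<comment> \<open>An element whose linear part is a combination of those of \<open>z\<close> and \<open>w\<close>, and which agrees with it in higher degree, differs from it by a constant.\<close>
  have mem: "normal_order h \<in> B" if "\<And>i j. i + j > 0 \<Longrightarrow> cf h i j =
    s * cf (Phi z) i j + t * cf (Phi w) i j" for h s t
  proof -
    define k where "k = h - (smult [:s:] (Phi z) + smult [:t:] (Phi w))"
    have "k = monom (monom (cf k 0 0) 0) 0"
      by (rule cf_eqI) (use that in \<open>auto simp: k_def coeff_monom\<close>)
    then have "normal_order k = weyl_const (cf k 0 0)"
      by (metis Phi_const normal_order_Phi)
    moreover have "normal_order h = normal_order k + (weyl_const s * z + weyl_const t * w)"
      by (simp add: k_def normal_order_diff normal_order_add normal_order_smult)
    ultimately show ?thesis using B by (auto intro!: is_subalgebraD)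
  qed
  have small: "cf (Phi z) i j = 0" "cf (Phi w) i j = 0" if "i + j > 1" for i j
    using affine[where i = i and j = j] that by auto
  have cases: "i = 1 \<and> j = 0 \<or> i = 0 \<and> j = 1 \<or> i + j > 1" if "i + j > 0" for i j :: nat
    using that by linarith
  have "normal_order (monom (monom 1 1) 0) \<in> B"
  proof (rule mem[of _ d "- b"])
    fix i j :: nat
    assume "i + j > 0"
    from cases[OF this] lin show "cf (monom (monom 1 1) 0) i j = d * cf (Phi z) i j + - b * cf (Phi w) i j"
      by (auto simp: small abcd coeff_monom algebra_simps)
  qed
  moreover have "normal_order (monom (monom 1 0) 1) \<in> B"
  proof (rule mem[of _ "- c" a])
    fix i j :: nat
    assume "i + j > 0"
    from cases[OF this] lin show "cf (monom (monom 1 0) 1) i j = - c * cf (Phi z) i j + a * cf (Phi w) i j"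
      by (auto simp: small abcd coeff_monom algebra_simps)
  qed
  ultimately show ?thesis by (simp only: normal_order_monom) simp
qed

lemma weights_le_min:
  assumes "weights_in \<rho> \<sigma> {..\<rho>} F" "0 < \<rho>" "\<rho> \<le> \<sigma>" "cf F i j \<noteq> 0"
  shows "i + j \<le> 1" "\<rho> < \<sigma> \<Longrightarrow> j = 0"
proof -
  have le: "\<rho> * real i + \<sigma> * real j \<le> \<rho>" using weights_inD[OF assms(1,4)] by simp
  have "\<rho> * real j \<le> \<sigma> * real j" using assms(3) by (simp add: mult_right_mono)
  then have "\<rho> * real (i + j) \<le> \<rho> * 1" using le by (simp add: distrib_left)
  with assms(2) have "real (i + j) \<le> 1" by (simp only: mult_le_cancel_left_pos)
  then show "i + j \<le> 1" by linarith
  show "j = 0" if "\<rho> < \<sigma>"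
  proof (rule ccontr)
    assume "j \<noteq> 0"
    then have "\<sigma> * 1 \<le> \<sigma> * real j" using assms by (intro mult_left_mono) auto
    moreover have "0 \<le> \<rho> * real i" using assms by simp
    ultimately show False using le that by simp
  qed
qed

text \<open>If \<open>\<rho> \<le> 0\<close> then \<open>z\<close> has no positive weights, and if \<open>\<sigma> \<le> 0\<close> then \<open>w\<close> has none. Otherwise the
  element bounded by the smaller of \<open>\<rho>\<close> and \<open>\<sigma>\<close> can contain nothing but a constant and the
  corresponding generator; for \<open>\<rho> = \<sigma>\<close> both elements are affine.\<close>

lemma subalgebra_standard_weights:
  fixes z w :: "'k::field_char_0 weyl"
  assumes B: "is_subalgebra B" "z \<in> B" "w \<in> B" and comm: "commutator z w = 1"
    and z: "weights_in \<rho> \<sigma> {..\<rho>} (Phi z)" and w: "weights_in \<rho> \<sigma> {..\<sigma>} (Phi w)" and pos: "\<rho> + \<sigma> > 0"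
  shows "weyl_p \<in> B \<and> weyl_q \<in> B"
proof -
  have mz: "- z \<in> B" using B by (simp add: subalgebra_uminus)
  have comm': "commutator w (- z) = 1" using comm by (simp add: commutator_def)
  consider "\<rho> \<le> 0" | "\<sigma> \<le> 0" | "0 < \<rho>" "\<rho> < \<sigma>" | "0 < \<sigma>" "\<sigma> < \<rho>" | "0 < \<rho>" "\<rho> = \<sigma>"
    by linarith
  then show ?thesis
  proof cases
    case 1
    then have "weights_in \<rho> \<sigma> {..0} (Phi z)" by (intro weights_in_mono[OF z]) auto
    from subalgebra_if_weights_nonpos[OF B comm this pos] show ?thesis .
  next
    case 2
    then have "weights_in \<rho> \<sigma> {..0} (Phi w)" by (intro weights_in_mono[OF w]) auto
    from subalgebra_if_weights_nonpos[OF B(1,3) mz comm' this pos] show ?thesis .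
  next
    case 3
    show ?thesis
      using weights_le_min[OF z] 3 by (intro subalgebra_affine_p[OF B comm]) fastforce
  next
    case 4
    show ?thesis
    proof (rule subalgebra_affine_q[OF B(1,3) mz comm'])
      fix i j
      assume ij: "cf (Phi w) i j \<noteq> 0"
      have le: "\<rho> * real i + \<sigma> * real j \<le> \<sigma>" using weights_inD[OF w ij] by simp
      have "i = 0"
      proof (rule ccontr)
        assume "i \<noteq> 0"
        then have "\<rho> * 1 \<le> \<rho> * real i" using 4 by (intro mult_left_mono) auto
        moreover have "0 \<le> \<sigma> * real j" using 4 by simp
        ultimately show False using le 4 by linarith
      qed
      with le 4 show "i = 0 \<and> j \<le> 1" by simp
    qed
  next
    case 5
    with weights_le_min[OF z] weights_le_min[of \<rho> \<sigma> "Phi w"] w show ?thesis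
      by (intro subalgebra_both_affine[OF B comm]) auto
  qed
qed

text \<open>The constant term of \<open>{f, g} = 1\<close> is a \<open>2 \<times> 2\<close> determinant, so one of its two products is
  nonzero: \<open>f\<close> contains \<open>X\<close> and \<open>g\<close> contains \<open>Y\<close>, or the other way round, and this reveals the
  weights of \<open>f\<close> and \<open>g\<close>.\<close>

lemma subalgebra_if_poisson_eq_1:
  fixes z w :: "'k::field_char_0 weyl"
  assumes B: "is_subalgebra B" "z \<in> B" "w \<in> B" and comm: "commutator z w = 1"
    and z: "top_part \<rho> \<sigma> r f (Phi z)" and w: "top_part \<rho> \<sigma> s g (Phi w)" and pos: "\<rho> + \<sigma> > 0"
    and poisson: "poisson f g = 1"
  shows "weyl_p \<in> B \<and> weyl_q \<in> B"
proof -
  have "cf f 1 0 \<noteq> 0 \<and> cf g 0 1 \<noteq> 0 \<or> cf f 0 1 \<noteq> 0 \<and> cf g 1 0 \<noteq> 0"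
    using poisson_eq_1_linear_part[OF poisson] by auto
  then show ?thesis
  proof
    assume "cf f 1 0 \<noteq> 0 \<and> cf g 0 1 \<noteq> 0"
    with weights_inD[OF top_partD(1)[OF z], where i = 1 and j = 0]
      weights_inD[OF top_partD(1)[OF w], where i = 0 and j = 1]
    have "r = \<rho>" "s = \<sigma>" by auto
    with top_partD(3)[OF z] top_partD(3)[OF w] show ?thesis
      by (intro subalgebra_standard_weights[OF B comm _ _ pos]) auto
  next
    assume "cf f 0 1 \<noteq> 0 \<and> cf g 1 0 \<noteq> 0"
    with weights_inD[OF top_partD(1)[OF z], where i = 0 and j = 1]
      weights_inD[OF top_partD(1)[OF w], where i = 1 and j = 0]
    have "r = \<sigma>" "s = \<rho>" by auto
    moreover have "commutator w (- z) = 1" using comm by (simp add: commutator_def)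
    moreover have "weights_in \<rho> \<sigma> {..r} (Phi (- z))"
      using top_partD(3)[OF z] by (simp add: Phi_uminus weights_in_uminus)
    ultimately show ?thesis
      using top_partD(3)[OF w] B
      by (intro subalgebra_standard_weights[OF B(1,3) _ _ _ _ pos, of "- z"]) (auto intro: subalgebra_uminus)
  qed
qed

section \<open>Descent\<close>

lemma polynomials_inE:
  assumes "g \<in> polynomials_in f"
  obtains P where "g = (\<Sum>k\<le>degree P. smult [:coeff P k:] (f ^ k))"
proof -
  from assms obtain P where "g = poly (map_poly (\<lambda>c. [:[:c:]:]) P) f"
    by (auto simp: polynomials_in_def)
  then have "g = (\<Sum>k\<le>degree P. smult [:coeff P k:] (f ^ k))"
    by (simp add: poly_altdef degree_map_poly coeff_map_poly)
  with that show ?thesis .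
qed

lemma weights_in_power: "weights_in \<rho> \<sigma> {r} f \<Longrightarrow> weights_in \<rho> \<sigma> {real k * r} (f ^ k)"
proof (induction k)
  case (Suc k)
  from weights_in_mult[OF Suc.prems Suc.IH[OF Suc.prems], of "{real (Suc k) * r}"]
  show ?case by (simp add: algebra_simps)
qed (simp add: weights_in_1)

text \<open>The summands \<open>c\<^sub>k f\<^sup>k\<close> of a polynomial in \<open>f\<close> are homogeneous of weight \<open>k r\<close>, so only those with
  \<open>k r = s\<close> survive; for \<open>r \<noteq> 0\<close> there is just one.\<close>

lemma homogeneous_polynomials_in:
  assumes f: "weights_in \<rho> \<sigma> {r} f" and g: "weights_in \<rho> \<sigma> {s} g" "g \<noteq> 0" "g \<in> polynomials_in f"
  obtains k where "s = real k * r" and "r \<noteq> 0 \<longrightarrow> (\<exists>c. g = smult [:c:] (f ^ k))"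
proof -
  obtain P where P: "g = (\<Sum>k\<le>degree P. smult [:coeff P k:] (f ^ k))"
    using g(3) by (rule polynomials_inE)
  let ?A = "{k \<in> {..degree P}. real k * r = s}" and ?B = "{k \<in> {..degree P}. real k * r \<noteq> s}"
  let ?t = "\<lambda>k. smult [:coeff P k:] (f ^ k)"
  have wt: "weights_in \<rho> \<sigma> {real k * r} (?t k)" for k
    by (rule weights_in_const[OF weights_in_power[OF f]])
  have "g = sum ?t ?A + sum ?t ?B"
    unfolding P by (subst sum.union_disjoint[symmetric]) (auto intro!: sum.cong)
  moreover have "weights_in \<rho> \<sigma> {s} (sum ?t ?A)"
  proof (rule weights_in_sum)
    show "weights_in \<rho> \<sigma> {s} (?t k)" if "k \<in> ?A" for k using wt[of k] that by simp
  qed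
  moreover have "weights_in \<rho> \<sigma> (- {s}) (sum ?t ?B)"
    by (rule weights_in_sum) (auto intro: weights_in_mono[OF wt])
  ultimately have "sum ?t ?B = 0"
    using weights_in_diff[OF g(1), of "sum ?t ?A"] weights_in_disjoint[of \<rho> \<sigma> "{s}" "sum ?t ?B" "- {s}"]
    by simp
  with \<open>g = sum ?t ?A + sum ?t ?B\<close> have gA: "g = sum ?t ?A" by simp
  with g(2) have "?A \<noteq> {}" by (metis sum.empty)
  then obtain k where k: "k \<in> ?A" by blast
  show ?thesis
  proof (rule that)
    show "s = real k * r" using k by simp
    have "?A = {k}" if "r \<noteq> 0" using k that by auto
    with gA show "r \<noteq> 0 \<longrightarrow> (\<exists>c. g = smult [:c:] (f ^ k))" by auto
  qed
qed

text \<open>The bound \<open>n r\<close> makes the descent an induction over natural numbers: a leading form \<open>c f\<^sup>k\<close> of \<open>w\<close>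
  has \<open>k < n\<close>, and \<open>w - c z\<^sup>k\<close>, which still satisfies \<open>[z, w - c z\<^sup>k] = 1\<close>, is bounded by
  \<open>k r\<close>.\<close>

lemma subalgebra_descent:
  fixes z w :: "'k::field_char_0 weyl"
  assumes B: "is_subalgebra B" "z \<in> B" and z: "top_part \<rho> \<sigma> r f (Phi z)" and pos: "\<rho> + \<sigma> > 0" "r > 0"
    and centralizer: "poisson_centralizer f \<subseteq> polynomials_in f"
    and w: "w \<in> B" "commutator z w = 1" "weights_in \<rho> \<sigma> {..<real n * r} (Phi w)"
  shows "weyl_p \<in> B \<and> weyl_q \<in> B"
  using w
proof (induction n arbitrary: w)
  have step: "weyl_p \<in> B \<and> weyl_q \<in> B \<or> (\<exists>k c. k < n \<and> weights_in \<rho> \<sigma> {..<real k * r} (Phi (w - weyl_const c * z ^ k)))"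
    if "w \<in> B" "commutator z w = 1" "weights_in \<rho> \<sigma> {..<real n * r} (Phi w)" for w n
  proof -
    define g where "g = leading_form \<rho> \<sigma> (Phi w)"
    define s where "s = vdeg \<rho> \<sigma> (Phi w)"
    have nz: "Phi w \<noteq> 0" by (rule commutator_eq_1_nonzero[OF that(2)])
    have tg: "top_part \<rho> \<sigma> s g (Phi w)" unfolding s_def g_def by (rule top_part_leading_form[OF nz])
    have g: "g \<noteq> 0" unfolding g_def by (rule leading_form_nonzero[OF nz])
    from poisson_top_parts[OF z tg pos(1) that(2)] show ?thesis
    proof
      assume "r + s = \<rho> + \<sigma> \<and> poisson f g = 1"
      with subalgebra_if_poisson_eq_1[OF B that(1,2) z tg pos(1)] show ?thesis by simp
    next
      assume "r + s > \<rho> + \<sigma> \<and> poisson f g = 0"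
      then have "g \<in> polynomials_in f" using centralizer by (auto simp: poisson_centralizer_def)
      from homogeneous_polynomials_in[OF top_partD(1)[OF z] top_partD(1)[OF tg] g this]
      obtain k where k: "s = real k * r" "r \<noteq> 0 \<longrightarrow> (\<exists>c. g = smult [:c:] (f ^ k))" .
      with pos obtain c where c: "g = smult [:c:] (f ^ k)" by auto
      have "s < real n * r"
      proof -
        obtain i j where ij: "cf g i j \<noteq> 0" using g cf_eqI[of g 0] by (metis coeff_0)
        then have "cf (Phi w) i j \<noteq> 0" by (auto simp: g_def cf_leading_form split: if_splits)
        from weights_inD[OF that(3) this] weights_inD[OF top_partD(1)[OF tg] ij] show ?thesis by simp
      qed
      then have "k < n" using pos(2) by (simp add: k(1))
      have "weights_in \<rho> \<sigma> {..<real k * r} ((Phi w - g) - smult [:c:] (Phi (z ^ k) - f ^ k))"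
        using weights_in_diff[OF top_partD(2)[OF tg, unfolded k(1)]
            weights_in_const[OF top_partD(2)[OF top_part_power[OF z pos(1), of k]]]] .
      moreover have "(Phi w - g) - smult [:c:] (Phi (z ^ k) - f ^ k) = Phi (w - weyl_const c * z ^ k)"
        by (simp add: c Phi_diff Phi_scale smult_diff_right)
      ultimately show ?thesis using \<open>k < n\<close> by auto
    qed
  qed
  {
    case 0
    from step[OF this] show ?case by simp
  next
    case (Suc n)
    from step[OF Suc.prems] show ?case
    proof
      assume "\<exists>k c. k < Suc n \<and> weights_in \<rho> \<sigma> {..<real k * r} (Phi (w - weyl_const c * z ^ k))"
      then obtain k c where k: "k \<le> n" "weights_in \<rho> \<sigma> {..<real k * r} (Phi (w - weyl_const c * z ^ k))"
        by (metis less_Suc_eq_le)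
      show ?case
      proof (rule Suc.IH)
        show "w - weyl_const c * z ^ k \<in> B"
          using B Suc.prems(1) by (intro subalgebra_diff is_subalgebraD subalgebra_power)
        have "z * (weyl_const c * z ^ k) = weyl_const c * z ^ k * z"
          by (metis mult.assoc power_commutes weyl_const_commute)
        with Suc.prems(2) show "commutator z (w - weyl_const c * z ^ k) = 1"
          by (simp add: commutator_def algebra_simps)
        have "real k * r \<le> real n * r" using k(1) pos(2) by simp
        then show "weights_in \<rho> \<sigma> {..<real n * r} (Phi (w - weyl_const c * z ^ k))"
          by (intro weights_in_mono[OF k(2)]) auto
      qed
    qed
  }
qed

text \<open>For \<open>r \<le> 0\<close> all polynomials in \<open>f\<close> have weights at most \<open>0\<close>, while \<open>{f, g} = 0\<close> would require
  \<open>s > \<rho> + \<sigma> - r > 0\<close>; so \<open>{f, g} = 1\<close> holds at once. Otherwise \<open>w\<close> has to be modified first.\<close>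

lemma subalgebra_contains_generators:
  fixes z w :: "'k::field_char_0 weyl"
  assumes B: "is_subalgebra B" "z \<in> B" "w \<in> B" and comm: "commutator z w = 1"
    and z: "top_part \<rho> \<sigma> r f (Phi z)" and pos: "\<rho> + \<sigma> > 0"
    and centralizer: "poisson_centralizer f \<subseteq> polynomials_in f"
  shows "weyl_p \<in> B \<and> weyl_q \<in> B"
proof -
  define s where "s = vdeg \<rho> \<sigma> (Phi w)"
  define g where "g = leading_form \<rho> \<sigma> (Phi w)"
  have nz: "Phi w \<noteq> 0" by (rule commutator_eq_1_nonzero[OF comm])
  have tg: "top_part \<rho> \<sigma> s g (Phi w)" unfolding s_def g_def by (rule top_part_leading_form[OF nz])
  have g: "g \<noteq> 0" unfolding g_def by (rule leading_form_nonzero[OF nz])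
  show ?thesis
  proof (cases "r > 0")
    case True
    obtain n where "s < real n * r" using reals_Archimedean3[OF True] by blast
    then have "weights_in \<rho> \<sigma> {..<real n * r} (Phi w)"
      by (intro weights_in_mono[OF top_partD(3)[OF tg]]) auto
    from subalgebra_descent[OF B(1,2) z pos True centralizer B(3) comm this] show ?thesis .
  next
    case False
    have "poisson f g \<noteq> 0"
    proof
      assume "poisson f g = 0"
      with poisson_top_parts[OF z tg pos comm] False pos have "s > 0" by auto
      have "g \<in> polynomials_in f"
        using \<open>poisson f g = 0\<close> centralizer by (auto simp: poisson_centralizer_def)
      from homogeneous_polynomials_in[OF top_partD(1)[OF z] top_partD(1)[OF tg] g this]
      obtain k where "s = real k * r" by blast
      moreover have "real k * r \<le> 0" using False by (simp add: mult_nonneg_nonpos)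
      ultimately show False using \<open>s > 0\<close> by simp
    qed
    with poisson_top_parts[OF z tg pos comm] have "poisson f g = 1" by auto
    from subalgebra_if_poisson_eq_1[OF B comm z tg pos this] show ?thesis .
  qed
qed

theorem theorem3p13:
  fixes z w :: "'k::field_char_0 weyl" and f :: "'k poly poly" and \<rho> \<sigma> :: real
  assumes "z \<noteq> 0"
    and "\<rho> + \<sigma> > 0"
    and "f = weyl_leading_form \<rho> \<sigma> z"
    and "poisson_centralizer f = polynomials_in f"
    and "commutator z w = 1"
  shows "generated_subalgebra {z, w} = UNIV"
proof -
  have "Phi z \<noteq> 0" using assms(1) by (metis normal_order_0 normal_order_Phi)
  then have z: "top_part \<rho> \<sigma> (vdeg \<rho> \<sigma> (Phi z)) f (Phi z)"
    unfolding assms(3) weyl_leading_form_def by (rule top_part_leading_form)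
  have "B = UNIV" if "is_subalgebra B" "{z, w} \<subseteq> B" for B
    using subalgebra_contains_generators[OF that(1) _ _ assms(5) z assms(2)] that assms(4)
    by (intro subalgebra_eq_UNIV) auto
  then show ?thesis by (auto simp: generated_subalgebra_def hull_def)
qed

end
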